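(* Let $\mathcal{M}$ be a smooth manifold and let $$0\to \hbar\,\boldsymbol{\Omega}^*\to\boldsymbol{\Omega}^*\stackrel{\mathcal P}{\to}\Omega^*(\mathcal{M})\to 0$$ be a deformation of the differential graded algebra $(\Omega^*(\mathcal{M}),d,\wedge)$ of smooth complex differential forms. For $\sigma,\rho\in\Omega^*(\mathcal{M})$ choose $\hat\sigma,\hat\rho\in\boldsymbol{\Omega}^*$ with $\mathcal P(\hat\sigma)=\sigma$, $\mathcal P(\hat\rho)=\rho$, and set $$\{\sigma,\rho\}:=\mathcal P\left(\tfrac{1}{i\hbar}[\hat\sigma,\hat\rho]\right),$$ where $[\cdot,\cdot]$ is the graded commutator in $\boldsymbol{\Omega}^*$ and $\tfrac1{i\hbar}[\hat\sigma,\hat\rho]$ denotes any element $a\in\boldsymbol{\Omega}^*$ with $i\hbar a=[\hat\sigma,\hat\rho]$. Then this defines a bracket on $\Omega^*(\mathcal{M})$, and with this bracket (together with $d$ and $\wedge$) $\Omega^*(\mathcal{M})$ is a differential graded Poisson algebra.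
   Context: Deformation: a deformation of an algebra $\mathcal A_0$ is an extension of algebras $0\to\hbar\mathbb{A}\to\mathbb{A}\stackrel{\mathcal P}{\to}\mathcal A_0\to0$, where $\hbar$ is a central multiplier of $\mathbb{A}$ and, for $a\in\mathbb{A}$, $\hbar^2a=0$ implies $a\in\hbar\mathbb{A}$. A deformation of a differential graded algebra is such an extension in which $\mathbb{A}=\boldsymbol{\Omega}^*$ is itself a differential graded algebra (associative, not necessarily graded commutative, over $\mathbb{C}$), $\mathcal P$ is a morphism of differential graded algebras, and $\hbar$ is of degree $0$ and commutes with $d$. The graded commutator is $[\hat\sigma,\hat\rho]=\hat\sigma\hat\rho-(-1)^{\deg\hat\sigma\deg\hat\rho}\hat\rho\hat\sigma$; since $\Omega^*(\mathcal M)$ is graded commutative, $[\hat\sigma,\hat\rho]\in\hbar\boldsymbol{\Omega}^*$. A differential graded Poisson algebra is a graded vector space $\Omega^*$ with operations $d$, $\wedge$, $\{\cdot,\cdot\}$ such that: (1) $d:\Omega^k\to\Omega^{k+1}$ is linear and $d^2=0$; (2) $(\Omega^*,\wedge)$ is an associative graded-commutative algebra; (3) $\{\cdot,\cdot\}$ is bilinear, of degree $0$, $\{\sigma,\rho\}=-(-1)^{\deg\sigma\deg\rho}\{\rho,\sigma\}$, and $\{\{\sigma,\rho\},\lambda\}=\{\sigma,\{\rho,\lambda\}\}-(-1)^{\deg\sigma\deg\rho}\{\rho,\{\sigma,\lambda\}\}$; (4) $d(\sigma\wedge\rho)=d\sigma\wedge\rho+(-1)^{\deg\sigma}\sigma\wedge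 d\rho$; (5) $d\{\sigma,\rho\}=\{d\sigma,\rho\}+(-1)^{\deg\sigma}\{\sigma,d\rho\}$; (6) $\{\sigma,\rho\wedge\lambda\}=\{\sigma,\rho\}\wedge\lambda+(-1)^{\deg\sigma\deg\rho}\rho\wedge\{\sigma,\lambda\}$. *)

theory Defs
  imports "HOL-Analysis.Analysis" "HOL-Library.Function_Algebras"
begin

section \<open>Graded vector spaces over the complex numbers\<close>

text \<open>
  A graded vector space is given by its homogeneous components \<open>G k\<close>, subspaces of an ambient
  vector space; the graded space itself is their (internal) direct sum, \<open>gr_total G\<close>.
  Degrees are integers, so that non-negatively graded spaces are those with \<open>G k = {0}\<close> for \<open>k < 0\<close>.
\<close>

definition gr_total :: "(int \<Rightarrow> 'a::comm_monoid_add set) \<Rightarrow> 'a set" where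
  "gr_total G = {(\<Sum>k\<in>K. c k) | K c. finite K \<and> (\<forall>k\<in>K. c k \<in> G k)}"

definition gr_part :: "(int \<Rightarrow> 'a::comm_monoid_add set) \<Rightarrow> 'a \<Rightarrow> int \<Rightarrow> 'a" where
  "gr_part G x = (THE c. finite {k. c k \<noteq> 0} \<and> (\<forall>k. c k \<in> G k) \<and> x = (\<Sum>k | c k \<noteq> 0. c k))"

text \<open>The graded commutator, extended bilinearly to sums of homogeneous elements.\<close>

definition graded_commutator ::
  "(complex \<Rightarrow> 'a::ab_group_add \<Rightarrow> 'a) \<Rightarrow> (int \<Rightarrow> 'a set) \<Rightarrow> ('a \<Rightarrow> 'a \<Rightarrow> 'a) \<Rightarrow> 'a \<Rightarrow> 'a \<Rightarrow> 'a" where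
  "graded_commutator smul G mul x y =
     (\<Sum>k | gr_part G x k \<noteq> 0. \<Sum>l | gr_part G y l \<noteq> 0.
        mul (gr_part G x k) (gr_part G y l)
          - smul ((-1) powi (k * l)) (mul (gr_part G y l) (gr_part G x k)))"

locale graded_vector_space = vector_space smul
  for smul :: "complex \<Rightarrow> 'a::ab_group_add \<Rightarrow> 'a" (infixr \<open>*s\<close> 75) +
  fixes G :: "int \<Rightarrow> 'a set"
  assumes subspace_component: "subspace (G k)"
    and independent_components:
      "\<lbrakk>finite K; \<And>k. k \<in> K \<Longrightarrow> c k \<in> G k; (\<Sum>k\<in>K. c k) = 0; k \<in> K\<rbrakk> \<Longrightarrow> c k = 0"


section \<open>Differential graded (Poisson) algebras\<close>

text \<open>Associative, but neither unital nor graded commutative in general.\<close>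

locale dg_algebra = graded_vector_space smul G
  for smul :: "complex \<Rightarrow> 'a::ab_group_add \<Rightarrow> 'a" (infixr \<open>*s\<close> 75) and G :: "int \<Rightarrow> 'a set" +
  fixes mul :: "'a \<Rightarrow> 'a \<Rightarrow> 'a" (infixl \<open>\<cdot>\<close> 70)
    and d :: "'a \<Rightarrow> 'a"
  assumes mult_degree: "\<lbrakk>x \<in> G k; y \<in> G l\<rbrakk> \<Longrightarrow> x \<cdot> y \<in> G (k + l)"
    and mult_add_left:
      "\<lbrakk>x \<in> gr_total G; y \<in> gr_total G; z \<in> gr_total G\<rbrakk> \<Longrightarrow> (x + y) \<cdot> z = x \<cdot> z + y \<cdot> z"
    and mult_add_right:
      "\<lbrakk>x \<in> gr_total G; y \<in> gr_total G; z \<in> gr_total G\<rbrakk> \<Longrightarrow> x \<cdot> (y + z) = x \<cdot> y + x \<cdot> z"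
    and mult_scale_left:
      "\<lbrakk>x \<in> gr_total G; y \<in> gr_total G\<rbrakk> \<Longrightarrow> (a *s x) \<cdot> y = a *s (x \<cdot> y)"
    and mult_scale_right:
      "\<lbrakk>x \<in> gr_total G; y \<in> gr_total G\<rbrakk> \<Longrightarrow> x \<cdot> (a *s y) = a *s (x \<cdot> y)"
    and mult_assoc:
      "\<lbrakk>x \<in> gr_total G; y \<in> gr_total G; z \<in> gr_total G\<rbrakk> \<Longrightarrow> (x \<cdot> y) \<cdot> z = x \<cdot> (y \<cdot> z)"
    and d_degree: "x \<in> G k \<Longrightarrow> d x \<in> G (k + 1)"
    and d_add: "\<lbrakk>x \<in> gr_total G; y \<in> gr_total G\<rbrakk> \<Longrightarrow> d (x + y) = d x + d y"
    and d_scale: "x \<in> gr_total G \<Longrightarrow> d (a *s x) = a *s d x"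
    and d_d: "x \<in> gr_total G \<Longrightarrow> d (d x) = 0"
    and d_mult: "\<lbrakk>x \<in> G k; y \<in> G l\<rbrakk> \<Longrightarrow> d (x \<cdot> y) = d x \<cdot> y + (-1) powi k *s (x \<cdot> d y)"

locale dg_poisson_algebra = dg_algebra smul G mul d
  for smul :: "complex \<Rightarrow> 'a::ab_group_add \<Rightarrow> 'a" (infixr \<open>*s\<close> 75) and G :: "int \<Rightarrow> 'a set"
    and mul :: "'a \<Rightarrow> 'a \<Rightarrow> 'a" (infixl \<open>\<cdot>\<close> 70) and d :: "'a \<Rightarrow> 'a" +
  fixes br :: "'a \<Rightarrow> 'a \<Rightarrow> 'a"
  assumes mult_graded_commute: "\<lbrakk>x \<in> G k; y \<in> G l\<rbrakk> \<Longrightarrow> x \<cdot> y = (-1) powi (k * l) *s (y \<cdot> x)"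
    and br_degree: "\<lbrakk>x \<in> G k; y \<in> G l\<rbrakk> \<Longrightarrow> br x y \<in> G (k + l)"
    and br_add_left:
      "\<lbrakk>x \<in> gr_total G; y \<in> gr_total G; z \<in> gr_total G\<rbrakk> \<Longrightarrow> br (x + y) z = br x z + br y z"
    and br_add_right:
      "\<lbrakk>x \<in> gr_total G; y \<in> gr_total G; z \<in> gr_total G\<rbrakk> \<Longrightarrow> br x (y + z) = br x y + br x z"
    and br_scale_left: "\<lbrakk>x \<in> gr_total G; y \<in> gr_total G\<rbrakk> \<Longrightarrow> br (a *s x) y = a *s br x y"
    and br_scale_right: "\<lbrakk>x \<in> gr_total G; y \<in> gr_total G\<rbrakk> \<Longrightarrow> br x (a *s y) = a *s br x y"
    and br_antisym: "\<lbrakk>x \<in> G k; y \<in> G l\<rbrakk> \<Longrightarrow> br x y = - ((-1) powi (k * l) *s br y x)"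
    and br_jacobi: "\<lbrakk>x \<in> G k; y \<in> G l; z \<in> G m\<rbrakk> \<Longrightarrow>
      br (br x y) z = br x (br y z) - (-1) powi (k * l) *s br y (br x z)"
    and d_br: "\<lbrakk>x \<in> G k; y \<in> G l\<rbrakk> \<Longrightarrow> d (br x y) = br (d x) y + (-1) powi k *s br x (d y)"
    and br_mult: "\<lbrakk>x \<in> G k; y \<in> G l; z \<in> G m\<rbrakk> \<Longrightarrow>
      br x (y \<cdot> z) = br x y \<cdot> z + (-1) powi (k * l) *s (y \<cdot> br x z)"


section \<open>Deformations\<close>

text \<open>
  An extension \<open>0 \<rightarrow> \<hbar>A \<rightarrow> A \<rightarrow> A0 \<rightarrow> 0\<close> of differential graded algebras, where \<open>A\<close> is
  \<open>(smul, G, mul, d)\<close> and \<open>A0\<close> is \<open>(smul0, G0, mul0, d0)\<close>.  The central multiplier \<open>\<hbar>\<close> is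
  given as the linear map \<open>x \<mapsto> \<hbar>x = x\<hbar>\<close> (it need not be an element of \<open>A\<close>).
  The axioms of a differential graded algebra are not assumed for \<open>A0\<close>, which is meant to be
  instantiated by a concrete structure.
\<close>

locale dga_deformation = dg_algebra smul G mul d
  for smul :: "complex \<Rightarrow> 'a::ab_group_add \<Rightarrow> 'a" (infixr \<open>*s\<close> 75) and G :: "int \<Rightarrow> 'a set"
    and mul :: "'a \<Rightarrow> 'a \<Rightarrow> 'a" (infixl \<open>\<cdot>\<close> 70) and d :: "'a \<Rightarrow> 'a" +
  fixes smul0 :: "complex \<Rightarrow> 'b::ab_group_add \<Rightarrow> 'b" and G0 :: "int \<Rightarrow> 'b set"
    and mul0 :: "'b \<Rightarrow> 'b \<Rightarrow> 'b" and d0 :: "'b \<Rightarrow> 'b"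
    and P :: "'a \<Rightarrow> 'b" and hbar :: "'a \<Rightarrow> 'a"
  assumes hbar_degree: "x \<in> G k \<Longrightarrow> hbar x \<in> G k"
    and hbar_add: "\<lbrakk>x \<in> gr_total G; y \<in> gr_total G\<rbrakk> \<Longrightarrow> hbar (x + y) = hbar x + hbar y"
    and hbar_scale: "x \<in> gr_total G \<Longrightarrow> hbar (a *s x) = a *s hbar x"
    and hbar_mult_left: "\<lbrakk>x \<in> gr_total G; y \<in> gr_total G\<rbrakk> \<Longrightarrow> hbar (x \<cdot> y) = hbar x \<cdot> y"
    and hbar_mult_right: "\<lbrakk>x \<in> gr_total G; y \<in> gr_total G\<rbrakk> \<Longrightarrow> hbar (x \<cdot> y) = x \<cdot> hbar y"
    and hbar_d: "x \<in> gr_total G \<Longrightarrow> d (hbar x) = hbar (d x)"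
    and P_degree: "x \<in> G k \<Longrightarrow> P x \<in> G0 k"
    and P_add: "\<lbrakk>x \<in> gr_total G; y \<in> gr_total G\<rbrakk> \<Longrightarrow> P (x + y) = P x + P y"
    and P_scale: "x \<in> gr_total G \<Longrightarrow> P (a *s x) = smul0 a (P x)"
    and P_mult: "\<lbrakk>x \<in> gr_total G; y \<in> gr_total G\<rbrakk> \<Longrightarrow> P (x \<cdot> y) = mul0 (P x) (P y)"
    and P_d: "x \<in> gr_total G \<Longrightarrow> P (d x) = d0 (P x)"
    and P_surj: "P ` gr_total G = gr_total G0"
    and P_kernel: "{x \<in> gr_total G. P x = 0} = hbar ` gr_total G"
    and hbar_hbar: "\<lbrakk>x \<in> gr_total G; hbar (hbar x) = 0\<rbrakk> \<Longrightarrow> x \<in> hbar ` gr_total G"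

text \<open>\<open>divides_commutator \<dots> x y a\<close> says that \<open>a\<close> is a possible value of \<open>[x, y] / (\<i> \<hbar>)\<close>.\<close>

definition divides_commutator ::
  "(complex \<Rightarrow> 'a::ab_group_add \<Rightarrow> 'a) \<Rightarrow> (int \<Rightarrow> 'a set) \<Rightarrow> ('a \<Rightarrow> 'a \<Rightarrow> 'a) \<Rightarrow> ('a \<Rightarrow> 'a)
    \<Rightarrow> 'a \<Rightarrow> 'a \<Rightarrow> 'a \<Rightarrow> bool" where
  "divides_commutator smul G mul hbar x y a \<longleftrightarrow>
     a \<in> gr_total G \<and> smul \<i> (hbar a) = graded_commutator smul G mul x y"

definition deformation_bracket ::
  "(complex \<Rightarrow> 'a::ab_group_add \<Rightarrow> 'a) \<Rightarrow> (int \<Rightarrow> 'a set) \<Rightarrow> ('a \<Rightarrow> 'a \<Rightarrow> 'a) \<Rightarrow> ('a \<Rightarrow> 'a)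
    \<Rightarrow> ('a \<Rightarrow> 'b) \<Rightarrow> 'b \<Rightarrow> 'b \<Rightarrow> 'b" where
  "deformation_bracket smul G mul hbar P \<sigma> \<rho> =
     (THE \<tau>. \<exists>x\<in>gr_total G. \<exists>y\<in>gr_total G. \<exists>a.
        P x = \<sigma> \<and> P y = \<rho> \<and> divides_commutator smul G mul hbar x y a \<and> \<tau> = P a)"


section \<open>Smooth manifolds\<close>

text \<open>
  Coordinate space of dimension \<open>n\<close> is \<^const>\<open>Euclidean_space\<close> \<open>n\<close>, the sequences vanishing from
  index \<open>n\<close> on; this makes \<open>n\<close> a term and includes \<open>n = 0\<close>.
\<close>

definition partial_deriv ::
  "nat \<Rightarrow> ((nat \<Rightarrow> real) \<Rightarrow> 'b::real_normed_vector) \<Rightarrow> (nat \<Rightarrow> real) \<Rightarrow> 'b" where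
  "partial_deriv i f x = vector_derivative (\<lambda>t. f (x(i := t))) (at (x i))"

text \<open>All partial derivatives up to order \<open>k\<close> exist and are continuous (for \<open>S\<close> open in
  \<^const>\<open>Euclidean_space\<close> \<open>n\<close>).\<close>

primrec Ck_on ::
  "nat \<Rightarrow> nat \<Rightarrow> (nat \<Rightarrow> real) set \<Rightarrow> ((nat \<Rightarrow> real) \<Rightarrow> 'b::real_normed_vector) \<Rightarrow> bool" where
  "Ck_on n 0 S f \<longleftrightarrow> continuous_map (subtopology (Euclidean_space n) S) euclidean f"
| "Ck_on n (Suc k) S f \<longleftrightarrow>
     continuous_map (subtopology (Euclidean_space n) S) euclidean f \<and>
     (\<forall>i<n. (\<forall>x\<in>S. (\<lambda>t. f (x(i := t))) differentiable (at (x i))) \<and>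
            Ck_on n k S (partial_deriv i f))"

definition smooth_on ::
  "nat \<Rightarrow> (nat \<Rightarrow> real) set \<Rightarrow> ((nat \<Rightarrow> real) \<Rightarrow> 'b::real_normed_vector) \<Rightarrow> bool" where
  "smooth_on n S f \<longleftrightarrow> (\<forall>k. Ck_on n k S f)"

type_synonym 'm chart = "'m set \<times> ('m \<Rightarrow> nat \<Rightarrow> real)"

definition is_chart :: "nat \<Rightarrow> 'm topology \<Rightarrow> 'm chart \<Rightarrow> bool" where
  "is_chart n X = (\<lambda>(U, \<phi>). openin X U \<and> openin (Euclidean_space n) (\<phi> ` U) \<and>
     homeomorphic_map (subtopology X U) (subtopology (Euclidean_space n) (\<phi> ` U)) \<phi>)"

definition smooth_manifold :: "nat \<Rightarrow> 'm topology \<Rightarrow> 'm chart set \<Rightarrow> bool" where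
  "smooth_manifold n X A \<longleftrightarrow>
     Hausdorff_space X \<and> second_countable X \<and>
     (\<forall>c\<in>A. is_chart n X c) \<and>
     (\<Union>(U, \<phi>)\<in>A. U) = topspace X \<and>
     (\<forall>(U, \<phi>)\<in>A. \<forall>(V, \<psi>)\<in>A. \<forall>i<n. smooth_on n (\<phi> ` (U \<inter> V)) (\<lambda>x. \<psi> (inv_into U \<phi> x) i))"

definition smooth_fun :: "nat \<Rightarrow> 'm chart set \<Rightarrow> ('m \<Rightarrow> 'b::real_normed_vector) \<Rightarrow> bool" where
  "smooth_fun n A f \<longleftrightarrow> (\<forall>(U, \<phi>)\<in>A. smooth_on n (\<phi> ` U) (f \<circ> inv_into U \<phi>))"

text \<open>
  Tangent vectors are derivations at \<open>p\<close> of the algebra of real smooth functions, extended by \<open>0\<close>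
  to arbitrary functions.  (Values of \<open>f\<close> outside the manifold are irrelevant: if \<open>f\<close> vanishes on
  the manifold, then \<open>f = f * g\<close> for some smooth \<open>g\<close> that vanishes on the manifold, so \<open>v f = 0\<close>.)
\<close>

type_synonym 'm tvec = "('m \<Rightarrow> real) \<Rightarrow> real"

definition tangent_space :: "nat \<Rightarrow> 'm chart set \<Rightarrow> 'm \<Rightarrow> 'm tvec set" where
  "tangent_space n A p = {v.
     (\<forall>f. \<not> smooth_fun n A f \<longrightarrow> v f = 0) \<and>
     (\<forall>f g a b. smooth_fun n A f \<longrightarrow> smooth_fun n A g \<longrightarrow>
        v (\<lambda>q. a * f q + b * g q) = a * v f + b * v g) \<and>
     (\<forall>f g. smooth_fun n A f \<longrightarrow> smooth_fun n A g \<longrightarrow>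
        v (\<lambda>q. f q * g q) = f p * v g + g p * v f)}"

definition coord_vec :: "nat \<Rightarrow> 'm chart set \<Rightarrow> 'm chart \<Rightarrow> 'm \<Rightarrow> nat \<Rightarrow> 'm tvec" where
  "coord_vec n A = (\<lambda>(U, \<phi>) p i f.
     if smooth_fun n A f then partial_deriv i (f \<circ> inv_into U \<phi>) (\<phi> p) else 0)"


section \<open>Complex differential forms\<close>

text \<open>
  A possibly inhomogeneous form assigns to a point \<open>p\<close> and a list of \<open>k\<close> tangent vectors at \<open>p\<close>
  the value of its component of degree \<open>k\<close>.
\<close>

type_synonym 'm form = "'m \<Rightarrow> 'm tvec list \<Rightarrow> complex"

definition form_scale :: "complex \<Rightarrow> 'm form \<Rightarrow> 'm form" where
  "form_scale c \<omega> = (\<lambda>p vs. c * \<omega> p vs)"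

definition diff_forms :: "nat \<Rightarrow> 'm topology \<Rightarrow> 'm chart set \<Rightarrow> int \<Rightarrow> 'm form set" where
  "diff_forms n X A k = {\<omega>.
     (\<forall>p vs. \<omega> p vs \<noteq> 0 \<longrightarrow>
        p \<in> topspace X \<and> set vs \<subseteq> tangent_space n A p \<and> int (length vs) = k) \<and>
     (\<forall>p\<in>topspace X. \<forall>us vs v w a b.
        set us \<union> set vs \<union> {v, w} \<subseteq> tangent_space n A p \<longrightarrow>
        \<omega> p (us @ (\<lambda>f. a * v f + b * w f) # vs) =
          complex_of_real a * \<omega> p (us @ v # vs) + complex_of_real b * \<omega> p (us @ w # vs)) \<and>
     (\<forall>p\<in>topspace X. \<forall>vs. \<not> distinct vs \<longrightarrow> \<omega> p vs = 0) \<and>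
     (\<forall>(U, \<phi>)\<in>A. \<forall>is. set is \<subseteq> {..<n} \<longrightarrow>
        smooth_on n (\<phi> ` U)
          (\<lambda>x. \<omega> (inv_into U \<phi> x) (map (coord_vec n A (U, \<phi>) (inv_into U \<phi> x)) is)))}"

text \<open>
  Wedge product by the shuffle formula: \<open>S\<close> is the set of positions of the arguments of \<open>\<omega>\<close>, and
  the sign is that of the corresponding shuffle.  There is no factorial factor, so
  \<open>(\<alpha> \<and> \<beta>)(u, v) = \<alpha> u * \<beta> v - \<alpha> v * \<beta> u\<close> for one-forms.
\<close>

definition shuffle_sign :: "nat \<Rightarrow> nat set \<Rightarrow> complex" where
  "shuffle_sign m S = (-1) ^ card {(i, j). i \<in> S \<and> j \<in> {..<m} - S \<and> j < i}"

definition wedge :: "'m form \<Rightarrow> 'm form \<Rightarrow> 'm form" where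
  "wedge \<omega> \<eta> = (\<lambda>p vs. \<Sum>S\<in>Pow {..<length vs}.
     shuffle_sign (length vs) S * \<omega> p (nths vs S) * \<eta> p (nths vs ({..<length vs} - S)))"

text \<open>
  The exterior derivative is determined by its components in charts,
  \<open>(d\<omega>)(\<partial>\<^bsub>i\<^sub>0\<^esub>, \<dots>, \<partial>\<^bsub>i\<^sub>k\<^esub>) = \<Sum>\<^sub>j (-1)\<^sup>j \<partial>\<^bsub>i\<^sub>j\<^esub> (\<omega>(\<dots>))\<close> with \<open>\<partial>\<^bsub>i\<^sub>j\<^esub>\<close> omitted among the arguments of \<open>\<omega>\<close>.
\<close>

definition ext_deriv :: "nat \<Rightarrow> 'm topology \<Rightarrow> 'm chart set \<Rightarrow> 'm form \<Rightarrow> 'm form" where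
  "ext_deriv n X A \<omega> = (THE \<eta>. \<eta> \<in> gr_total (diff_forms n X A) \<and>
     (\<forall>(U, \<phi>)\<in>A. \<forall>p\<in>U. \<forall>is. set is \<subseteq> {..<n} \<longrightarrow>
        \<eta> p (map (coord_vec n A (U, \<phi>) p) is) =
          (\<Sum>j<length is. (-1) ^ j *
             partial_deriv (is ! j)
               (\<lambda>x. \<omega> (inv_into U \<phi> x)
                  (map (coord_vec n A (U, \<phi>) (inv_into U \<phi> x)) (take j is @ drop (Suc j) is)))
               (\<phi> p))))"

end

(*
  The multiplication, the differential and the graded commutator of the deformation all commute
  with hbar, so every axiom of the bracket is an identity of graded commutators in the deformation,
  divided by i hbar (by (i hbar)^2 for the Jacobi identity). The quotients are only determined up
  to elements annihilated by hbar, or by hbar^2; by hypothesis these lie in the image of hbar,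
  which P kills. Changing a lift by hbar u changes the quotient by a commutator with u, which P
  kills because forms are graded commutative. The axioms for d and wedge themselves are pushed
  forward along P, so of the manifold one needs only that forms are a graded vector space on which
  wedge is graded commutative.
*)

theory Submission
  imports Defs
begin

no_notation vector_scalar_mult (infixl \<open>*s\<close> 70)

section \<open>Homogeneous components\<close>

text \<open>What shapes the proof is the mismatch between degrees and total spaces. The signs in the
  commutator identities depend on degrees, so these identities are proved for homogeneous elements,
  while surjectivity of \<open>P\<close> and exactness are given only on \<open>gr_total G\<close>.
  Uniqueness of the homogeneous decomposition closes the gap: \<open>P\<close> and
  \<open>hbar\<close> are additive and preserve degrees, hence commute with taking parts, so a
  suitable part of any lift or of any quotient is a homogeneous lift or quotient. The Jacobi
  identity is where the square of \<open>hbar\<close> enters: an inner bracket is itself represented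
  by a quotient, and the outer commutator of that quotient is divided once more. Clearing both
  denominators shows only that the two sides agree after multiplication by \<open>hbar\<close>
  twice.\<close>

context graded_vector_space
begin

lemma component_zero [simp]: "0 \<in> G k"
  and component_add: "x \<in> G k \<Longrightarrow> y \<in> G k \<Longrightarrow> x + y \<in> G k"
  and component_scale: "x \<in> G k \<Longrightarrow> a *s x \<in> G k"
  and component_diff: "x \<in> G k \<Longrightarrow> y \<in> G k \<Longrightarrow> x - y \<in> G k"
  using subspace_component[of k] by (auto intro: subspace_0 subspace_add subspace_scale subspace_diff)

lemma gr_totalE:
  assumes "x \<in> gr_total G"
  obtains c where "finite {k. c k \<noteq> 0}" "\<And>k. c k \<in> G k" "x = (\<Sum>k | c k \<noteq> 0. c k)"
proof -
  from assms obtain K c where K: "finite K" "\<forall>k\<in>K. c k \<in> G k" "x = (\<Sum>k\<in>K. c k)"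
    by (auto simp: gr_total_def)
  \<comment> \<open>The family \<open>c\<close> is arbitrary outside \<open>K\<close>; cutting it
    off there gives the finite support that the description in \<open>gr_part\<close> asks
    for.\<close>
  define c' where "c' = (\<lambda>k. if k \<in> K then c k else 0)"
  have sub: "{k. c' k \<noteq> 0} \<subseteq> K" by (auto simp: c'_def)
  have "x = (\<Sum>k\<in>K. c' k)" using K by (simp add: c'_def)
  also have "\<dots> = (\<Sum>k | c' k \<noteq> 0. c' k)"
    using K(1) sub by (intro sum.mono_neutral_right) auto
  finally show ?thesis
    using K sub by (intro that[of c']) (auto simp: c'_def intro: finite_subset)
qed

lemma decomposition_unique:
  assumes c: "finite {k. c k \<noteq> 0}" "\<And>k. c k \<in> G k"
    and c': "finite {k. c' k \<noteq> 0}" "\<And>k. c' k \<in> G k"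
    and eq: "(\<Sum>k | c k \<noteq> 0. c k) = (\<Sum>k | c' k \<noteq> 0. c' k)"
  shows "c = c'"
proof
  fix k
  \<comment> \<open>Inserting \<open>k\<close> puts it among the summation indices even when both
    families vanish there.\<close>
  let ?K = "insert k ({k. c k \<noteq> 0} \<union> {k. c' k \<noteq> 0})"
  have "(\<Sum>k\<in>?K. c k) = (\<Sum>k | c k \<noteq> 0. c k)" "(\<Sum>k\<in>?K. c' k) = (\<Sum>k | c' k \<noteq> 0. c' k)"
    using c c' by (intro sum.mono_neutral_right; auto)+
  hence "(\<Sum>k\<in>?K. c k - c' k) = 0"
    using eq by (simp add: sum_subtractf del: sum.insert)
  hence "c k - c' k = 0"
    using c c' by (intro independent_components[of ?K "\<lambda>k. c k - c' k"]) (auto intro: component_diff)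
  thus "c k = c' k" by simp
qed

text \<open>Uniqueness of decompositions makes the definite description in \<open>gr_part\<close>
  denote; every later computation of parts goes through this rule.\<close>

lemma gr_part_eqI:
  assumes "finite {k. c k \<noteq> 0}" "\<And>k. c k \<in> G k" "x = (\<Sum>k | c k \<noteq> 0. c k)"
  shows "gr_part G x = c"
  unfolding gr_part_def using assms decomposition_unique by (intro the_equality) blast+

lemma gr_part_sum:
  assumes "finite K" "\<And>k. k \<in> K \<Longrightarrow> c k \<in> G k"
  shows "gr_part G (\<Sum>k\<in>K. c k) = (\<lambda>k. if k \<in> K then c k else 0)"
proof (rule gr_part_eqI)
  let ?c = "\<lambda>k. if k \<in> K then c k else 0"
  show "finite {k. ?c k \<noteq> 0}" by (rule finite_subset[OF _ assms(1)]) auto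
  have "(\<Sum>k\<in>K. c k) = (\<Sum>k\<in>K. ?c k)" by simp
  also have "\<dots> = (\<Sum>k | ?c k \<noteq> 0. ?c k)"
    using assms(1) by (intro sum.mono_neutral_right) auto
  finally show "(\<Sum>k\<in>K. c k) = (\<Sum>k | ?c k \<noteq> 0. ?c k)" .
qed (use assms in auto)

lemma
  assumes "x \<in> gr_total G"
  shows finite_gr_part: "finite {k. gr_part G x k \<noteq> 0}"
    and gr_part_component: "gr_part G x k \<in> G k"
    and sum_gr_part: "(\<Sum>k | gr_part G x k \<noteq> 0. gr_part G x k) = x"
proof -
  obtain c where c: "finite {k. c k \<noteq> 0}" "\<And>k. c k \<in> G k" "x = (\<Sum>k | c k \<noteq> 0. c k)"
    by (rule gr_totalE[OF assms]) blast
  hence "gr_part G x = c" by (rule gr_part_eqI)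
  with c show "finite {k. gr_part G x k \<noteq> 0}" "gr_part G x k \<in> G k"
    "(\<Sum>k | gr_part G x k \<noteq> 0. gr_part G x k) = x" by auto
qed

lemma sum_gr_part_superset:
  assumes "x \<in> gr_total G" "finite K" "{k. gr_part G x k \<noteq> 0} \<subseteq> K"
  shows "(\<Sum>k\<in>K. gr_part G x k) = x"
proof -
  have "(\<Sum>k\<in>K. gr_part G x k) = (\<Sum>k | gr_part G x k \<noteq> 0. gr_part G x k)"
    using assms by (intro sum.mono_neutral_right) auto
  thus ?thesis using sum_gr_part[OF assms(1)] by simp
qed

lemma gr_totalI: "finite K \<Longrightarrow> (\<And>k. k \<in> K \<Longrightarrow> c k \<in> G k) \<Longrightarrow> (\<Sum>k\<in>K. c k) \<in> gr_total G"
  unfolding gr_total_def by blast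

lemma component_gr_total: "x \<in> G k \<Longrightarrow> x \<in> gr_total G"
  using gr_totalI[of "{k}" "\<lambda>_. x"] by simp

lemma gr_part_homogeneous: "x \<in> G k \<Longrightarrow> gr_part G x = (\<lambda>j. if j = k then x else 0)"
  using gr_part_sum[of "{k}" "\<lambda>_. x"] by simp

lemma gr_part_homogeneous_eq: "x \<in> G k \<Longrightarrow> gr_part G x k = x"
  by (simp add: gr_part_homogeneous)

lemma
  assumes x: "x \<in> gr_total G" and y: "y \<in> gr_total G"
  shows gr_total_add: "x + y \<in> gr_total G"
    and gr_part_add: "gr_part G (x + y) k = gr_part G x k + gr_part G y k"
proof -
  let ?K = "{k. gr_part G x k \<noteq> 0} \<union> {k. gr_part G y k \<noteq> 0}"
  have K: "finite ?K" using x y by (simp add: finite_gr_part)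
  have eq: "x + y = (\<Sum>k\<in>?K. gr_part G x k + gr_part G y k)"
    using sum_gr_part_superset[OF x K] sum_gr_part_superset[OF y K] by (simp add: sum.distrib)
  have G: "gr_part G x k + gr_part G y k \<in> G k" for k
    using x y by (intro component_add gr_part_component)
  show "x + y \<in> gr_total G" unfolding eq by (rule gr_totalI[OF K G])
  show "gr_part G (x + y) k = gr_part G x k + gr_part G y k"
    unfolding eq using gr_part_sum[OF K G] by simp
qed

lemma
  assumes x: "x \<in> gr_total G"
  shows gr_total_scale: "a *s x \<in> gr_total G"
    and gr_part_scale: "gr_part G (a *s x) k = a *s gr_part G x k"
proof -
  let ?K = "{k. gr_part G x k \<noteq> 0}"
  have K: "finite ?K" using x by (simp add: finite_gr_part)
  have eq: "a *s x = (\<Sum>k\<in>?K. a *s gr_part G x k)"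
    using sum_gr_part[OF x] by (simp flip: scale_sum_right)
  have G: "a *s gr_part G x k \<in> G k" for k
    using x by (intro component_scale gr_part_component)
  show "a *s x \<in> gr_total G" unfolding eq by (rule gr_totalI[OF K G])
  show "gr_part G (a *s x) k = a *s gr_part G x k"
    unfolding eq using gr_part_sum[OF K G] by simp
qed

lemma gr_total_zero: "0 \<in> gr_total G"
  by (rule component_gr_total[OF component_zero[of 0]])

lemma gr_total_diff: "x \<in> gr_total G \<Longrightarrow> y \<in> gr_total G \<Longrightarrow> x - y \<in> gr_total G"
  using gr_total_add[of x "(-1) *s y"] gr_total_scale[of y "-1"] by simp

lemma gr_total_sum: "finite K \<Longrightarrow> (\<And>k. k \<in> K \<Longrightarrow> f k \<in> gr_total G) \<Longrightarrow>
    (\<Sum>k\<in>K. f k) \<in> gr_total G"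
  by (induction rule: finite_induct) (auto simp: gr_total_zero gr_total_add)

text \<open>Reduces additive statements to homogeneous elements. Zero needs no case of its own,
  being homogeneous of degree 0. The inner induction carries membership along with \<open>Q\<close>
  because \<open>add\<close> demands it of the partial sums.\<close>

lemma gr_total_induct [consumes 1, case_names homogeneous add]:
  assumes x: "x \<in> gr_total G"
    and hom: "\<And>k x. x \<in> G k \<Longrightarrow> Q x"
    and add: "\<And>x y. \<lbrakk>x \<in> gr_total G; y \<in> gr_total G; Q x; Q y\<rbrakk> \<Longrightarrow> Q (x + y)"
  shows "Q x"
proof -
  have "(\<Sum>k\<in>K. c k) \<in> gr_total G \<and> Q (\<Sum>k\<in>K. c k)" if "finite K" "\<And>k. c k \<in> G k" for K c
    using that(1)
  proof induction
    case empty
    thus ?case using hom[of 0 0] by (simp add: gr_total_zero)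
  next
    case (insert k K)
    thus ?case
      using add[of "c k" "sum c K"] hom[OF that(2)] component_gr_total[OF that(2)]
      by (simp add: gr_total_add)
  qed
  from this[of "{k. gr_part G x k \<noteq> 0}" "gr_part G x"] show ?thesis
    using x by (simp add: finite_gr_part gr_part_component sum_gr_part)
qed

lemma gr_total_induct2:
  assumes x: "x \<in> gr_total G" and y: "y \<in> gr_total G"
    and Q0: "\<And>k l x y. x \<in> G k \<Longrightarrow> y \<in> G l \<Longrightarrow> Q x y"
    and Q1: "\<And>x y z. \<lbrakk>x \<in> gr_total G; y \<in> gr_total G; z \<in> gr_total G; Q x z; Q y z\<rbrakk> \<Longrightarrow> Q (x + y) z"
    and Q2: "\<And>x y z. \<lbrakk>x \<in> gr_total G; y \<in> gr_total G; z \<in> gr_total G; Q z x; Q z y\<rbrakk> \<Longrightarrow> Q z (x + y)"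
  shows "Q x y"
  using x
proof (induction rule: gr_total_induct)
  case (homogeneous k x)
  from y show ?case
    by (induction rule: gr_total_induct) (use homogeneous Q0 Q2 component_gr_total in blast)+
qed (use y Q1 in blast)

end


section \<open>The graded commutator\<close>

lemma minus_one_powi_square: "((-1::complex) powi k) * ((-1) powi k) = 1"
  by (simp flip: power_int_mult_distrib)

lemma minus_one_powi_square_left: "((-1::complex) powi k) * (((-1) powi k) * a) = a"
  by (metis minus_one_powi_square mult.assoc mult_1)

lemmas sign_simps = power_int_add minus_one_powi_square minus_one_powi_square_left

context dg_algebra
begin

lemmas total_intros = component_gr_total gr_total_add gr_total_scale gr_total_diff

lemma mult_total:
  assumes "x \<in> gr_total G" "y \<in> gr_total G"
  shows "x \<cdot> y \<in> gr_total G"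
  using assms(1)
proof (induction rule: gr_total_induct)
  case (homogeneous k x)
  from assms(2) show ?case
  proof (induction rule: gr_total_induct)
    case (homogeneous l y)
    thus ?case using \<open>x \<in> G k\<close> mult_degree component_gr_total by blast
  next
    case (add y z)
    thus ?case using \<open>x \<in> G k\<close> by (simp add: mult_add_right total_intros)
  qed
next
  case (add x z)
  thus ?case using assms by (simp add: mult_add_left total_intros)
qed

lemma d_total: "x \<in> gr_total G \<Longrightarrow> d x \<in> gr_total G"
  by (induction rule: gr_total_induct) (auto simp: d_add intro: gr_total_add component_gr_total d_degree)

lemma mult_zero_left: "y \<in> gr_total G \<Longrightarrow> 0 \<cdot> y = 0"
  and mult_zero_right: "y \<in> gr_total G \<Longrightarrow> y \<cdot> 0 = 0"
  using mult_add_left[of 0 0 y] mult_add_right[of y 0 0] gr_total_zero by simp_all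

lemma mult_diff_left:
  assumes "x \<in> gr_total G" "y \<in> gr_total G" "z \<in> gr_total G"
  shows "(x - y) \<cdot> z = x \<cdot> z - y \<cdot> z"
  using mult_add_left[of "x - y" y z] assms by (simp add: gr_total_diff)

lemma mult_diff_right:
  assumes "x \<in> gr_total G" "y \<in> gr_total G" "z \<in> gr_total G"
  shows "z \<cdot> (x - y) = z \<cdot> x - z \<cdot> y"
  using mult_add_right[of z "x - y" y] assms by (simp add: gr_total_diff)

lemma d_diff: "x \<in> gr_total G \<Longrightarrow> y \<in> gr_total G \<Longrightarrow> d (x - y) = d x - d y"
  using d_add[of "x - y" y] by (simp add: gr_total_diff)

abbreviation comm where "comm \<equiv> graded_commutator smul G mul"

text \<open>The defining sum runs over the exact supports, which differ between \<open>x\<close>,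
  \<open>y\<close> and \<open>x + y\<close>. Extra indices contribute products with 0, so all
  commutators in one equation can be summed over a common index set.\<close>

lemma comm_superset:
  assumes x: "x \<in> gr_total G" and y: "y \<in> gr_total G"
    and K: "finite K" "{k. gr_part G x k \<noteq> 0} \<subseteq> K"
    and L: "finite L" "{k. gr_part G y k \<noteq> 0} \<subseteq> L"
  shows "comm x y = (\<Sum>k\<in>K. \<Sum>l\<in>L. gr_part G x k \<cdot> gr_part G y l
           - (-1) powi (k * l) *s (gr_part G y l \<cdot> gr_part G x k))"
proof -
  have T: "gr_part G x k \<in> gr_total G" "gr_part G y k \<in> gr_total G" for k
    using x y by (auto intro: component_gr_total gr_part_component)
  show ?thesis
    unfolding graded_commutator_def
    by (rule sum.mono_neutral_cong_left[OF K],
        simp add: mult_zero_left mult_zero_right T,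
        rule sum.mono_neutral_cong_left[OF L])
       (auto simp add: mult_zero_left mult_zero_right T)
qed

lemma comm_homogeneous:
  assumes "x \<in> G k" "y \<in> G l"
  shows "comm x y = x \<cdot> y - (-1) powi (k * l) *s (y \<cdot> x)"
  by (subst comm_superset[of x y "{k}" "{l}"])
     (use assms in \<open>auto simp: gr_part_homogeneous component_gr_total split: if_splits\<close>)

lemma comm_degree: "x \<in> G k \<Longrightarrow> y \<in> G l \<Longrightarrow> comm x y \<in> G (k + l)"
  using mult_degree[of x k y l] mult_degree[of y l x k]
  by (simp add: comm_homogeneous component_diff component_scale add.commute)

lemma comm_add_left:
  assumes "x \<in> gr_total G" "y \<in> gr_total G" "z \<in> gr_total G"
  shows "comm (x + y) z = comm x z + comm y z"
proof -
  \<comment> \<open>Parts of \<open>x\<close> and \<open>y\<close> may cancel, so the union of the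
    supports only contains the support of \<open>x + y\<close>; that is enough.\<close>
  let ?K = "{k. gr_part G x k \<noteq> 0} \<union> {k. gr_part G y k \<noteq> 0}" and ?L = "{k. gr_part G z k \<noteq> 0}"
  have fin: "finite ?K" "finite ?L" using assms by (simp_all add: finite_gr_part)
  have T: "gr_part G x k \<in> gr_total G" "gr_part G y k \<in> gr_total G" "gr_part G z k \<in> gr_total G" for k
    using assms by (auto intro: component_gr_total gr_part_component)
  have "comm (x + y) z = (\<Sum>k\<in>?K. \<Sum>l\<in>?L. gr_part G (x + y) k \<cdot> gr_part G z l
           - (-1) powi (k * l) *s (gr_part G z l \<cdot> gr_part G (x + y) k))"
    using assms fin by (intro comm_superset) (auto intro: gr_total_add simp: gr_part_add)
  also have "\<dots> = comm x z + comm y z"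
    using assms fin T
    by (simp add: comm_superset[of _ _ ?K ?L] gr_part_add mult_add_left mult_add_right
        scale_right_distrib add_diff_add sum.distrib)
  finally show ?thesis .
qed

lemma comm_add_right:
  assumes "x \<in> gr_total G" "y \<in> gr_total G" "z \<in> gr_total G"
  shows "comm z (x + y) = comm z x + comm z y"
proof -
  let ?K = "{k. gr_part G x k \<noteq> 0} \<union> {k. gr_part G y k \<noteq> 0}" and ?L = "{k. gr_part G z k \<noteq> 0}"
  have fin: "finite ?K" "finite ?L" using assms by (simp_all add: finite_gr_part)
  have T: "gr_part G x k \<in> gr_total G" "gr_part G y k \<in> gr_total G" "gr_part G z k \<in> gr_total G" for k
    using assms by (auto intro: component_gr_total gr_part_component)
  have "comm z (x + y) = (\<Sum>k\<in>?L. \<Sum>l\<in>?K. gr_part G z k \<cdot> gr_part G (x + y) l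
           - (-1) powi (k * l) *s (gr_part G (x + y) l \<cdot> gr_part G z k))"
    using assms fin by (intro comm_superset) (auto intro: gr_total_add simp: gr_part_add)
  also have "\<dots> = comm z x + comm z y"
    using assms fin T
    by (simp add: comm_superset[of _ _ ?L ?K] gr_part_add mult_add_left mult_add_right
        scale_right_distrib add_diff_add sum.distrib)
  finally show ?thesis .
qed

lemma comm_total: "x \<in> gr_total G \<Longrightarrow> y \<in> gr_total G \<Longrightarrow> comm x y \<in> gr_total G"
  by (rule gr_total_induct2[where Q = "\<lambda>x y. comm x y \<in> gr_total G"])
     (auto simp: comm_add_left comm_add_right intro: gr_total_add component_gr_total comm_degree)

lemma comm_scale_left: "x \<in> gr_total G \<Longrightarrow> y \<in> gr_total G \<Longrightarrow> comm (a *s x) y = a *s comm x y"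
proof (rule gr_total_induct2[where Q = "\<lambda>x y. comm (a *s x) y = a *s comm x y"], goal_cases)
  \<comment> \<open>Goals 1 and 2 are the memberships of the two arguments; goal 3 is the
    homogeneous case, and the remaining goals are additivity in each argument.\<close>
  case (3 k l x y)
  thus ?case
    by (simp add: comm_homogeneous[of _ k _ l] component_scale component_gr_total mult_scale_left
        mult_scale_right scale_right_diff_distrib mult.commute)
qed (auto simp: comm_add_left comm_add_right scale_right_distrib gr_total_scale)

lemma comm_scale_right: "x \<in> gr_total G \<Longrightarrow> y \<in> gr_total G \<Longrightarrow> comm x (a *s y) = a *s comm x y"
proof (rule gr_total_induct2[where Q = "\<lambda>x y. comm x (a *s y) = a *s comm x y"], goal_cases)
  case (3 k l x y)
  thus ?case
    by (simp add: comm_homogeneous[of _ k _ l] component_scale component_gr_total mult_scale_left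
        mult_scale_right scale_right_diff_distrib mult.commute)
qed (auto simp: comm_add_left comm_add_right scale_right_distrib gr_total_scale)

lemma comm_antisym:
  "x \<in> G k \<Longrightarrow> y \<in> G l \<Longrightarrow> comm x y = - ((-1) powi (k * l) *s comm y x)"
  by (simp add: comm_homogeneous[of x k y l] comm_homogeneous[of y l x k] scale_right_diff_distrib
      mult.commute[of l k] sign_simps)

text \<open>Apply the Leibniz rule to both orders of the product. Raising one degree by 1 turns
  (-1)^(kl) into (-1)^((k+1)l) or (-1)^(k(l+1)), and these are the signs that the Leibniz rule
  produces.\<close>

lemma d_comm:
  assumes "x \<in> G k" "y \<in> G l"
  shows "d (comm x y) = comm (d x) y + (-1) powi k *s comm x (d y)"
proof -
  have T: "x \<in> gr_total G" "y \<in> gr_total G" using assms by (auto intro: component_gr_total)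
  have D: "d x \<in> G (k + 1)" "d y \<in> G (l + 1)" using assms by (auto intro: d_degree)
  show ?thesis
    using assms D T
    by (simp add: comm_homogeneous[of x k y l] comm_homogeneous[of "d x" "k + 1" y l]
       comm_homogeneous[of x k "d y" "l + 1"] d_diff d_scale d_mult[of x k y l] d_mult[of y l x k]
       mult_total total_intros scale_right_distrib scale_right_diff_distrib
       sign_simps algebra_simps)
qed

text \<open>By associativity the right side telescopes: the two terms with
  \<open>y \<cdot> x \<cdot> z\<close> cancel.\<close>

lemma comm_mult:
  assumes "x \<in> G k" "y \<in> G l" "z \<in> G m"
  shows "comm x (y \<cdot> z) = comm x y \<cdot> z + (-1) powi (k * l) *s (y \<cdot> comm x z)"
proof -
  have T: "x \<in> gr_total G" "y \<in> gr_total G" "z \<in> gr_total G" using assms by (auto intro: component_gr_total)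
  show ?thesis
    using assms T
    by (simp add: comm_homogeneous[of x k "y \<cdot> z" "l + m"] comm_homogeneous[of x k y l]
       comm_homogeneous[of x k z m] mult_degree mult_diff_left mult_diff_right
       mult_scale_left mult_scale_right mult_total total_intros mult_assoc
       scale_right_diff_distrib distrib_left sign_simps)
qed

text \<open>Expand into monomials by associativity. On the right those in the orders x z y and y z x
  cancel, leaving the four monomials of the left side.\<close>

lemma comm_jacobi:
  assumes "x \<in> G k" "y \<in> G l" "z \<in> G m"
  shows "comm (comm x y) z = comm x (comm y z) - (-1) powi (k * l) *s comm y (comm x z)"
proof -
  have T: "x \<in> gr_total G" "y \<in> gr_total G" "z \<in> gr_total G" using assms by (auto intro: component_gr_total)
  \<comment> \<open>The outer commutators are expanded first, while \<open>comm_degree\<close> still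
    supplies the degrees of the inner ones.\<close>
  have e: "comm (comm x y) z = comm x y \<cdot> z - (-1) powi ((k + l) * m) *s (z \<cdot> comm x y)"
    "comm x (comm y z) = x \<cdot> comm y z - (-1) powi (k * (l + m)) *s (comm y z \<cdot> x)"
    "comm y (comm x z) = y \<cdot> comm x z - (-1) powi (l * (k + m)) *s (comm x z \<cdot> y)"
    using assms by (auto intro!: comm_homogeneous comm_degree)
  show ?thesis
    unfolding e using assms T
    by (simp add: comm_homogeneous[of x k y l]
       comm_homogeneous[of x k z m] comm_homogeneous[of y l z m] mult_diff_left mult_diff_right
       mult_scale_left mult_scale_right mult_total total_intros mult_assoc
       scale_right_diff_distrib distrib_left distrib_right sign_simps mult.commute[of l k] mult_ac)
qed

end


section \<open>Deformations of graded-commutative algebras\<close>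

locale commutative_dga_deformation =
  dga_deformation smul G mul d smul0 G0 mul0 d0 P hbar + base: graded_vector_space smul0 G0
  for smul :: "complex \<Rightarrow> 'a::ab_group_add \<Rightarrow> 'a" (infixr \<open>*s\<close> 75) and G :: "int \<Rightarrow> 'a set"
    and mul :: "'a \<Rightarrow> 'a \<Rightarrow> 'a" (infixl \<open>\<cdot>\<close> 70) and d :: "'a \<Rightarrow> 'a"
    and smul0 :: "complex \<Rightarrow> 'b::ab_group_add \<Rightarrow> 'b" and G0 :: "int \<Rightarrow> 'b set"
    and mul0 :: "'b \<Rightarrow> 'b \<Rightarrow> 'b" and d0 :: "'b \<Rightarrow> 'b"
    and P :: "'a \<Rightarrow> 'b" and hbar :: "'a \<Rightarrow> 'a" +
  assumes mul0_graded_commute: "\<lbrakk>\<sigma> \<in> G0 k; \<rho> \<in> G0 l\<rbrakk> \<Longrightarrow> mul0 \<sigma> \<rho> = smul0 ((-1) powi (k * l)) (mul0 \<rho> \<sigma>)"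
begin

abbreviation divides where "divides \<equiv> divides_commutator smul G mul hbar"
abbreviation br where "br \<equiv> deformation_bracket smul G mul hbar P"

section \<open>Compatibility of \<open>P\<close> and \<open>hbar\<close> with the grading, and
  lifts\<close>

lemma hbar_total: "x \<in> gr_total G \<Longrightarrow> hbar x \<in> gr_total G"
  by (induction rule: gr_total_induct) (auto simp: hbar_add intro: gr_total_add component_gr_total hbar_degree)

lemma hbar_diff: "x \<in> gr_total G \<Longrightarrow> y \<in> gr_total G \<Longrightarrow> hbar (x - y) = hbar x - hbar y"
  using hbar_add[of "x - y" y] by (simp add: gr_total_diff)

lemma P_diff: "x \<in> gr_total G \<Longrightarrow> y \<in> gr_total G \<Longrightarrow> P (x - y) = P x - P y"
  using P_add[of "x - y" y] by (simp add: gr_total_diff)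

lemma hbar_zero: "hbar 0 = 0"
  using hbar_add[OF gr_total_zero gr_total_zero] by simp

lemma P_zero: "P 0 = 0"
  using P_add[OF gr_total_zero gr_total_zero] by simp

lemma P_hbar: "x \<in> gr_total G \<Longrightarrow> P (hbar x) = 0"
  using P_kernel by blast

lemma lift:
  assumes "\<sigma> \<in> gr_total G0"
  obtains x where "x \<in> gr_total G" "P x = \<sigma>"
  using assms P_surj by (metis imageE)

lemma P_sum: "finite K \<Longrightarrow> (\<And>k. k \<in> K \<Longrightarrow> f k \<in> gr_total G) \<Longrightarrow> P (\<Sum>k\<in>K. f k) = (\<Sum>k\<in>K. P (f k))"
  by (induction rule: finite_induct) (auto simp: P_zero P_add gr_total_sum)

lemma hbar_sum: "finite K \<Longrightarrow> (\<And>k. k \<in> K \<Longrightarrow> f k \<in> gr_total G) \<Longrightarrow> hbar (\<Sum>k\<in>K. f k) = (\<Sum>k\<in>K. hbar (f k))"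
  by (induction rule: finite_induct) (auto simp: hbar_zero hbar_add gr_total_sum)

text \<open>An additive map of degree 0 sends a homogeneous decomposition to one of the image, and
  uniqueness identifies the parts. This yields homogeneous lifts and homogeneous quotients.\<close>

lemma
  assumes x: "x \<in> gr_total G"
  shows P_gr_part: "P (gr_part G x k) = gr_part G0 (P x) k"
    and hbar_gr_part: "hbar (gr_part G x k) = gr_part G (hbar x) k"
proof -
  let ?K = "{k. gr_part G x k \<noteq> 0}"
  have K: "finite ?K" using x by (rule finite_gr_part)
  have T: "gr_part G x k \<in> gr_total G" for k using x component_gr_total gr_part_component by blast
  have "P x = (\<Sum>k\<in>?K. P (gr_part G x k))" "hbar x = (\<Sum>k\<in>?K. hbar (gr_part G x k))"
    using P_sum[OF K, of "gr_part G x"] hbar_sum[OF K, of "gr_part G x"] T sum_gr_part[OF x] by simp_all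
  moreover have "gr_part G0 (\<Sum>k\<in>?K. P (gr_part G x k)) = (\<lambda>k. if k \<in> ?K then P (gr_part G x k) else 0)"
    using K x by (intro base.gr_part_sum P_degree gr_part_component)
  moreover have "gr_part G (\<Sum>k\<in>?K. hbar (gr_part G x k)) = (\<lambda>k. if k \<in> ?K then hbar (gr_part G x k) else 0)"
    using K x by (intro gr_part_sum hbar_degree gr_part_component)
  ultimately show "P (gr_part G x k) = gr_part G0 (P x) k" "hbar (gr_part G x k) = gr_part G (hbar x) k"
    by (auto simp: P_zero hbar_zero)
qed

lemma homogeneous_lift:
  assumes "\<sigma> \<in> G0 k"
  obtains x where "x \<in> G k" "P x = \<sigma>"
proof -
  obtain x where x: "x \<in> gr_total G" "P x = \<sigma>" using assms lift base.component_gr_total by blast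
  show ?thesis
  proof
    show "gr_part G x k \<in> G k" using x(1) by (rule gr_part_component)
    show "P (gr_part G x k) = \<sigma>" using x assms by (simp add: P_gr_part base.gr_part_homogeneous_eq)
  qed
qed

lemma base_dg_algebra: "dg_algebra smul0 G0 mul0 d0"
proof
  show "mul0 x y \<in> G0 (k + l)" if xy: "x \<in> G0 k" "y \<in> G0 l" for x y k l
  proof -
    obtain u where u: "u \<in> G k" "P u = x" using xy homogeneous_lift by blast
    obtain v where v: "v \<in> G l" "P v = y" using xy homogeneous_lift by blast
    show ?thesis
      using u v P_degree[OF mult_degree[OF u(1) v(1)]] by (simp add: P_mult component_gr_total)
  qed
  \<comment> \<open>For the laws on the total space arbitrary lifts suffice: the reversed morphism
    rules collect each side into \<open>P\<close> of one expression upstairs.\<close>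
  show "mul0 (x + y) z = mul0 x z + mul0 y z"
    if "x \<in> gr_total G0" "y \<in> gr_total G0" "z \<in> gr_total G0" for x y z
    using that by (auto elim!: lift simp: mult_add_left mult_total gr_total_add simp flip: P_mult P_add)
  show "mul0 x (y + z) = mul0 x y + mul0 x z"
    if "x \<in> gr_total G0" "y \<in> gr_total G0" "z \<in> gr_total G0" for x y z
    using that by (auto elim!: lift simp: mult_add_right mult_total gr_total_add simp flip: P_mult P_add)
  show "mul0 (smul0 a x) y = smul0 a (mul0 x y)"
    if "x \<in> gr_total G0" "y \<in> gr_total G0" for x y a
    using that by (auto elim!: lift simp: mult_scale_left mult_total gr_total_scale simp flip: P_mult P_scale)
  show "mul0 x (smul0 a y) = smul0 a (mul0 x y)"
    if "x \<in> gr_total G0" "y \<in> gr_total G0" for x y a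
    using that by (auto elim!: lift simp: mult_scale_right mult_total gr_total_scale simp flip: P_mult P_scale)
  show "mul0 (mul0 x y) z = mul0 x (mul0 y z)"
    if "x \<in> gr_total G0" "y \<in> gr_total G0" "z \<in> gr_total G0" for x y z
    using that by (auto elim!: lift simp: mult_assoc mult_total simp flip: P_mult)
  show "d0 x \<in> G0 (k + 1)" if xy: "x \<in> G0 k" for x k
  proof -
    obtain u where u: "u \<in> G k" "P u = x" using xy homogeneous_lift by blast
    show ?thesis
      using u P_degree[OF d_degree[OF u(1)]] by (simp add: P_d component_gr_total)
  qed
  show "d0 (x + y) = d0 x + d0 y" if "x \<in> gr_total G0" "y \<in> gr_total G0" for x y
    using that by (auto elim!: lift simp: d_add d_total gr_total_add simp flip: P_d P_add)
  show "d0 (smul0 a x) = smul0 a (d0 x)" if "x \<in> gr_total G0" for x a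
    using that by (auto elim!: lift simp: d_scale d_total gr_total_scale simp flip: P_d P_scale)
  show "d0 (d0 x) = 0" if "x \<in> gr_total G0" for x
    using that by (auto elim!: lift simp: d_d d_total P_zero simp flip: P_d)
  show "d0 (mul0 x y) = mul0 (d0 x) y + smul0 ((-1) powi k) (mul0 x (d0 y))"
    if xy: "x \<in> G0 k" "y \<in> G0 l" for x y k l
  proof -
    obtain u where u: "u \<in> G k" "P u = x" using xy homogeneous_lift by blast
    obtain v where v: "v \<in> G l" "P v = y" using xy homogeneous_lift by blast
    have T: "u \<in> gr_total G" "v \<in> gr_total G" using u v component_gr_total by blast+
    have "P (d (u \<cdot> v)) = P (d u \<cdot> v + (-1) powi k *s (u \<cdot> d v))"
      using d_mult u v by simp
    thus ?thesis
      using T by (simp add: P_d P_add P_scale P_mult mult_total d_total gr_total_scale u v)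
  qed
qed

text \<open>\<open>P\<close> turns the commutator into that of the base, which is zero. Together
  with \<open>P_kernel\<close> this makes every commutator divisible by \<open>hbar\<close>.\<close>

lemma P_comm: "x \<in> gr_total G \<Longrightarrow> y \<in> gr_total G \<Longrightarrow> P (comm x y) = 0"
proof (rule gr_total_induct2[where Q = "\<lambda>x y. P (comm x y) = 0"], goal_cases)
  case (3 k l x y)
  moreover from 3 have "mul0 (P x) (P y) = smul0 ((-1) powi (k * l)) (mul0 (P y) (P x))"
    by (intro mul0_graded_commute P_degree)
  ultimately show ?case
    by (simp add: comm_homogeneous[of _ k _ l] P_diff P_mult P_scale component_gr_total mult_total
        gr_total_scale)
qed (auto simp: comm_add_left comm_add_right P_add comm_total)

text \<open>Centrality lets \<open>hbar\<close> pass into either factor of a product, and degree 0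
  means that no sign changes.\<close>

lemma comm_hbar_left: "x \<in> gr_total G \<Longrightarrow> y \<in> gr_total G \<Longrightarrow> comm (hbar x) y = hbar (comm x y)"
proof (rule gr_total_induct2[where Q = "\<lambda>x y. comm (hbar x) y = hbar (comm x y)"], goal_cases)
  case (3 k l x y)
  thus ?case
    by (simp add: comm_homogeneous[of _ k _ l] hbar_degree component_gr_total hbar_diff hbar_scale
      mult_total gr_total_scale flip: hbar_mult_left hbar_mult_right)
qed (auto simp: comm_add_left comm_add_right hbar_add comm_total hbar_total)

lemma comm_hbar_right: "x \<in> gr_total G \<Longrightarrow> y \<in> gr_total G \<Longrightarrow> comm x (hbar y) = hbar (comm x y)"
proof (rule gr_total_induct2[where Q = "\<lambda>x y. comm x (hbar y) = hbar (comm x y)"], goal_cases)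
  case (3 k l x y)
  thus ?case
    by (simp add: comm_homogeneous[of _ k _ l] hbar_degree component_gr_total hbar_diff hbar_scale
      mult_total gr_total_scale flip: hbar_mult_left hbar_mult_right)
qed (auto simp: comm_add_left comm_add_right hbar_add comm_total hbar_total)

section \<open>Quotients of commutators by i times \<open>hbar\<close>\<close>

lemma ihbar_add: "x \<in> gr_total G \<Longrightarrow> y \<in> gr_total G \<Longrightarrow> \<i> *s hbar (x + y) = \<i> *s hbar x + \<i> *s hbar y"
  and ihbar_scale: "x \<in> gr_total G \<Longrightarrow> \<i> *s hbar (c *s x) = c *s (\<i> *s hbar x)"
  by (simp_all add: hbar_add hbar_scale scale_right_distrib mult.commute)

lemma P_eqI_hbar_hbar:
  assumes "a \<in> gr_total G" "b \<in> gr_total G" "hbar (hbar a) = hbar (hbar b)"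
  shows "P a = P b"
proof -
  have "hbar (hbar (a - b)) = 0" using assms by (simp add: hbar_diff hbar_total)
  hence "a - b \<in> hbar ` gr_total G" using assms by (intro hbar_hbar gr_total_diff)
  hence "P (a - b) = 0" using P_hbar by auto
  thus ?thesis using assms by (simp add: P_diff)
qed

text \<open>Applying \<open>hbar\<close> once more to an equality keeps it, so the hypothesis on the
  square also covers division by a single \<open>hbar\<close>.\<close>

lemma P_eqI_hbar: "a \<in> gr_total G \<Longrightarrow> b \<in> gr_total G \<Longrightarrow> hbar a = hbar b \<Longrightarrow> P a = P b"
  by (rule P_eqI_hbar_hbar) simp_all

lemma P_eq_lift:
  assumes "x \<in> gr_total G" "y \<in> gr_total G" "P x = P y"
  obtains u where "u \<in> gr_total G" "x = y + hbar u"
proof -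
  have "x - y \<in> {z \<in> gr_total G. P z = 0}" using assms by (simp add: P_diff gr_total_diff)
  then obtain u where u: "u \<in> gr_total G" "x - y = hbar u" using P_kernel by blast
  show ?thesis by (rule that[OF u(1)]) (simp flip: u(2))
qed

lemma divides_total: "divides x y a \<Longrightarrow> a \<in> gr_total G"
  and divides_eq: "divides x y a \<Longrightarrow> \<i> *s hbar a = comm x y"
  and dividesI: "a \<in> gr_total G \<Longrightarrow> \<i> *s hbar a = comm x y \<Longrightarrow> divides x y a"
  by (simp_all add: divides_commutator_def)

text \<open>The scalar \<open>-\<i>\<close> is the inverse of \<open>\<i>\<close>; in this solved
  form the equation can be used for rewriting.\<close>

lemma divides_hbar: "divides x y a \<Longrightarrow> hbar a = (-\<i>) *s comm x y"
  by (drule divides_eq[symmetric]) (simp del: scale_minus_left)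

lemma divides_exists:
  assumes "x \<in> gr_total G" "y \<in> gr_total G"
  shows "\<exists>a. divides x y a"
proof -
  have "comm x y \<in> {z \<in> gr_total G. P z = 0}" using assms by (simp add: comm_total P_comm)
  then obtain u where u: "u \<in> gr_total G" "comm x y = hbar u" using P_kernel by blast
  hence "divides x y ((-\<i>) *s u)" by (intro dividesI) (auto simp: gr_total_scale hbar_scale simp del: scale_minus_left)
  thus ?thesis ..
qed

text \<open>The commutator has degree \<open>k + l\<close> and \<open>hbar\<close> commutes with
  taking parts, so that part of any quotient is again a quotient. This gives the bracket degree
  0.\<close>

lemma divides_exists_homogeneous:
  assumes "x \<in> G k" "y \<in> G l"
  shows "\<exists>a\<in>G (k + l). divides x y a"
proof -
  obtain a where a: "divides x y a"
    using divides_exists assms component_gr_total by blast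
  have T: "a \<in> gr_total G" using a by (rule divides_total)
  have "\<i> *s hbar (gr_part G a (k + l)) = gr_part G (\<i> *s hbar a) (k + l)"
    using T by (simp add: hbar_gr_part gr_part_scale hbar_total)
  also have "\<dots> = comm x y"
    using assms by (simp add: divides_eq[OF a] gr_part_homogeneous_eq comm_degree)
  finally have "divides x y (gr_part G a (k + l))"
    using T by (intro dividesI) (auto intro: component_gr_total gr_part_component)
  thus ?thesis using T gr_part_component by blast
qed

lemma P_divides_unique:
  assumes "x \<in> gr_total G" "y \<in> gr_total G" "x' \<in> gr_total G" "y' \<in> gr_total G"
    and "P x = P x'" "P y = P y'" "divides x y a" "divides x' y' a'"
  shows "P a = P a'"
proof -
  obtain u where u: "u \<in> gr_total G" "x = x' + hbar u" using assms P_eq_lift by metis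
  obtain v where v: "v \<in> gr_total G" "y = y' + hbar v" using assms P_eq_lift by metis
  \<comment> \<open>The lifts are exchanged one at a time, first \<open>x\<close> against the old
    \<open>y\<close>, then \<open>y\<close> against the new \<open>x'\<close>; hence no term with
    \<open>hbar\<close> squared arises.\<close>
  define w where "w = comm u y + comm x' v"
  have w: "w \<in> gr_total G" "P w = 0"
    using assms u(1) v(1) by (simp_all add: w_def comm_total gr_total_add P_add P_comm)
  have "comm x y = comm x' y + hbar (comm u y)"
    using u assms by (simp add: comm_add_left hbar_total comm_hbar_left)
  also have "comm x' y = comm x' y' + hbar (comm x' v)"
    using v assms by (simp add: comm_add_right hbar_total comm_hbar_right)
  finally have "comm x y = comm x' y' + hbar w"
    using assms u v by (simp add: w_def hbar_add comm_total add_ac)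
  hence "hbar a = hbar (a' + (-\<i>) *s w)"
    using assms w divides_hbar[OF assms(7)] divides_hbar[OF assms(8)] divides_total[OF assms(8)]
    by (simp add: hbar_add hbar_scale gr_total_scale scale_right_distrib del: scale_minus_left)
  hence "P a = P (a' + (-\<i>) *s w)"
    using assms(7,8) w(1) divides_total by (intro P_eqI_hbar gr_total_add gr_total_scale)
  thus ?thesis
    using assms(8) w divides_total by (simp add: P_add P_scale gr_total_scale del: scale_minus_left)
qed

text \<open>The given quotient provides existence and \<open>P_divides_unique\<close> uniqueness for
  the definite description. Each axiom below then amounts to choosing convenient lifts and
  quotients.\<close>

lemma br_eq:
  assumes "x \<in> gr_total G" "y \<in> gr_total G" "divides x y a"
  shows "br (P x) (P y) = P a"
  unfolding deformation_bracket_def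
  by (rule the_equality) (use assms P_divides_unique in blast)+

lemma divides_add_left:
  assumes "x \<in> gr_total G" "x' \<in> gr_total G" "y \<in> gr_total G" "divides x y a" "divides x' y a'"
  shows "divides (x + x') y (a + a')"
  using assms
  by (intro dividesI) (simp_all add: divides_total gr_total_add hbar_add scale_right_distrib divides_eq comm_add_left)

lemma divides_add_right:
  assumes "x \<in> gr_total G" "x' \<in> gr_total G" "y \<in> gr_total G" "divides y x a" "divides y x' a'"
  shows "divides y (x + x') (a + a')"
  using assms
  by (intro dividesI) (simp_all add: divides_total gr_total_add hbar_add scale_right_distrib divides_eq comm_add_right)

lemma divides_scale:
  assumes "x \<in> gr_total G" "y \<in> gr_total G" "divides x y a"
  shows "divides (c *s x) y (c *s a)" "divides x (c *s y) (c *s a)"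
  using assms
  by (auto intro!: dividesI simp: divides_total gr_total_scale ihbar_scale comm_scale_left comm_scale_right
      divides_eq simp del: scale_scale)

theorem bracket_poisson: "dg_poisson_algebra smul0 G0 mul0 d0 br"
proof -
  interpret base: dg_algebra smul0 G0 mul0 d0 by (rule base_dg_algebra)
  show ?thesis
  proof
    show "mul0 x y = smul0 ((-1) powi (k * l)) (mul0 y x)" if "x \<in> G0 k" "y \<in> G0 l" for x y k l
      using that by (rule mul0_graded_commute)
  next
    fix \<sigma> \<rho> k l assume "\<sigma> \<in> G0 k" "\<rho> \<in> G0 l"
    then obtain x y where xy: "x \<in> G k" "P x = \<sigma>" "y \<in> G l" "P y = \<rho>" by (metis homogeneous_lift)
    note T = component_gr_total[OF xy(1)] component_gr_total[OF xy(3)]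
    obtain a where a: "a \<in> G (k + l)" "divides x y a" using xy divides_exists_homogeneous by blast
    note Ta = divides_total[OF a(2)]
    have br: "br \<sigma> \<rho> = P a" using br_eq[OF T a(2)] xy by simp
    show "br \<sigma> \<rho> \<in> G0 (k + l)" unfolding br using a(1) by (rule P_degree)
    show "br \<sigma> \<rho> = - (smul0 ((-1) powi (k * l)) (br \<rho> \<sigma>))"
    proof -
      \<comment> \<open>Antisymmetry upstairs provides a quotient for the swapped pair. The minus
        sign is written as a scalar so that the scaling rules apply.\<close>
      have "divides y x (- ((-1) powi (k * l) *s a))"
        unfolding scale_minus_left[symmetric]
        using Ta comm_antisym[OF xy(3,1)]
        by (intro dividesI)
           (simp_all only: gr_total_scale ihbar_scale divides_eq[OF a(2)] mult.commute[of l k] flip: scale_minus_left)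
      from br_eq[OF T(2,1) this] have "br \<rho> \<sigma> = smul0 (- ((-1) powi (k * l))) (P a)"
        using xy Ta by (simp add: P_scale gr_total_scale flip: scale_minus_left)
      thus ?thesis unfolding br by (simp add: sign_simps)
    qed
    show "d0 (br \<sigma> \<rho>) = br (d0 \<sigma>) \<rho> + smul0 ((-1) powi k) (br \<sigma> (d0 \<rho>))"
    proof -
      obtain p where p: "divides (d x) y p" using divides_exists T d_total by blast
      obtain q where q: "divides x (d y) q" using divides_exists T d_total by blast
      note Tpq = divides_total[OF p] divides_total[OF q]
      \<comment> \<open>The elements \<open>d a\<close> and \<open>p + (-1) powi k *s q\<close> need
        not be equal; only their multiples by \<open>hbar\<close> are compared.\<close>
      have "hbar (d a) = hbar (p + (-1) powi k *s q)"
        using Ta Tpq T d_comm[OF xy(1,3)]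
        by (simp add: hbar_d[symmetric] divides_hbar[OF a(2)] divides_hbar[OF p] divides_hbar[OF q]
            hbar_add hbar_scale gr_total_scale d_scale comm_total scale_right_distrib scale_left_commute
            del: scale_minus_left)
      hence "P (d a) = P (p + (-1) powi k *s q)"
        using Ta Tpq by (intro P_eqI_hbar) (auto intro: d_total gr_total_add gr_total_scale)
      thus ?thesis
        using Ta Tpq T br_eq[OF d_total[OF T(1)] T(2) p] br_eq[OF T(1) d_total[OF T(2)] q] xy
        by (simp add: br P_d P_add P_scale gr_total_scale)
    qed
    fix \<tau> m assume "\<tau> \<in> G0 m"
    then obtain z where z: "z \<in> G m" "P z = \<tau>" by (metis homogeneous_lift)
    note Tz = component_gr_total[OF z(1)]
    obtain q where q: "divides x z q" using divides_exists T Tz by blast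
    obtain p where p: "divides y z p" using divides_exists T Tz by blast
    note Tpq = divides_total[OF p] divides_total[OF q]
    have br': "br \<sigma> \<tau> = P q" "br \<rho> \<tau> = P p" using br_eq[OF T(1) Tz q] br_eq[OF T(2) Tz p] xy z by simp_all
    show "br \<sigma> (mul0 \<rho> \<tau>) = mul0 (br \<sigma> \<rho>) \<tau> + smul0 ((-1) powi (k * l)) (mul0 \<rho> (br \<sigma> \<tau>))"
    proof -
      \<comment> \<open>Since \<open>hbar\<close> can be absorbed into either factor, the quotients
        for (x, y) and (x, z) combine into one for (x, yz), with no cancellation of
        \<open>hbar\<close>.\<close>
      have "divides x (y \<cdot> z) (a \<cdot> z + (-1) powi (k * l) *s (y \<cdot> q))"
      proof (rule dividesI)
        have "\<i> *s hbar (a \<cdot> z) = comm x y \<cdot> z" "\<i> *s hbar (y \<cdot> q) = y \<cdot> comm x z"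
          using T Tz Ta Tpq
          by (simp_all add: hbar_mult_left[of a z] hbar_mult_right[of y q] hbar_total
              mult_scale_left mult_scale_right flip: divides_eq[OF a(2)] divides_eq[OF q])
        thus "\<i> *s hbar (a \<cdot> z + (-1) powi (k * l) *s (y \<cdot> q)) = comm x (y \<cdot> z)"
          using T Tz Ta Tpq
          by (simp only: ihbar_add ihbar_scale gr_total_scale mult_total comm_mult[OF xy(1,3) z(1)])
      qed (use T Tz Ta Tpq in \<open>auto intro!: gr_total_add gr_total_scale mult_total\<close>)
      from br_eq[OF T(1) mult_total[OF T(2) Tz] this] show ?thesis
        using T Tz Ta Tpq xy z by (simp add: br br' P_add P_scale P_mult mult_total gr_total_scale)
    qed
    show "br (br \<sigma> \<rho>) \<tau> = br \<sigma> (br \<rho> \<tau>) - smul0 ((-1) powi (k * l)) (br \<rho> (br \<sigma> \<tau>))"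
    proof -
      \<comment> \<open>The inner quotients \<open>a\<close>, \<open>p\<close>, \<open>q\<close> are
        lifts of the inner brackets, so \<open>b\<close>, \<open>r\<close>, \<open>t\<close>
        represent the nested ones.\<close>
      obtain b where b: "divides a z b" using divides_exists Ta Tz by blast
      obtain r where r: "divides x p r" using divides_exists T Tpq by blast
      obtain t where t: "divides y q t" using divides_exists T Tpq by blast
      note Tb = divides_total[OF b] divides_total[OF r] divides_total[OF t]
      \<comment> \<open>One \<open>hbar\<close> turns the outer quotient into a commutator; the
        other moves inside it and clears the inner quotient.\<close>
      have e: "hbar (hbar b) = (-\<i>) *s ((-\<i>) *s comm (comm x y) z)"
        "hbar (hbar r) = (-\<i>) *s ((-\<i>) *s comm x (comm y z))"
        "hbar (hbar t) = (-\<i>) *s ((-\<i>) *s comm y (comm x z))"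
        using T Tz Ta Tpq Tb
        by (simp_all only: divides_hbar[OF b] divides_hbar[OF r] divides_hbar[OF t] hbar_scale comm_total
            comm_hbar_left[OF Ta Tz, symmetric] comm_hbar_right[OF T(1) Tpq(1), symmetric]
            comm_hbar_right[OF T(2) Tpq(2), symmetric] divides_hbar[OF a(2)] divides_hbar[OF p]
            divides_hbar[OF q] comm_scale_left comm_scale_right)
      have "hbar (hbar b) = hbar (hbar (r - (-1) powi (k * l) *s t))"
        using Tb comm_jacobi[OF xy(1,3) z(1)]
        by (simp add: hbar_diff hbar_scale hbar_total gr_total_scale e scale_right_diff_distrib)
      hence "P b = P (r - (-1) powi (k * l) *s t)"
        using Tb by (intro P_eqI_hbar_hbar gr_total_diff gr_total_scale)
      thus ?thesis
        using Tb br_eq[OF Ta Tz b] br_eq[OF T(1) Tpq(1) r] br_eq[OF T(2) Tpq(2) t] xy z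
        by (simp add: br br' P_diff P_scale gr_total_scale)
    qed
  next
    \<comment> \<open>Bilinearity is claimed on the whole direct sum, so the lifts here are
      inhomogeneous.\<close>
    fix \<sigma> \<rho> \<tau> assume "\<sigma> \<in> gr_total G0" "\<rho> \<in> gr_total G0" "\<tau> \<in> gr_total G0"
    then obtain x y z where xyz: "x \<in> gr_total G" "P x = \<sigma>" "y \<in> gr_total G" "P y = \<rho>" "z \<in> gr_total G" "P z = \<tau>"
      by (metis lift)
    obtain a where a: "divides x y a" using xyz divides_exists by blast
    obtain b where b: "divides x z b" using xyz divides_exists by blast
    obtain c where c: "divides y z c" using xyz divides_exists by blast
    note T = divides_total[OF a] divides_total[OF b] divides_total[OF c]
    show "br (\<sigma> + \<rho>) \<tau> = br \<sigma> \<tau> + br \<rho> \<tau>"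
      using br_eq[OF gr_total_add _ divides_add_left[OF _ _ _ b c]] br_eq[OF _ _ b] br_eq[OF _ _ c] xyz T
      by (simp add: P_add)
    show "br \<sigma> (\<rho> + \<tau>) = br \<sigma> \<rho> + br \<sigma> \<tau>"
      using br_eq[OF _ gr_total_add divides_add_right[OF _ _ _ a b]] br_eq[OF _ _ a] br_eq[OF _ _ b] xyz T
      by (simp add: P_add)
  next
    fix \<sigma> \<rho> s assume "\<sigma> \<in> gr_total G0" "\<rho> \<in> gr_total G0"
    then obtain x y where xy: "x \<in> gr_total G" "P x = \<sigma>" "y \<in> gr_total G" "P y = \<rho>"
      by (metis lift)
    obtain a where a: "divides x y a" using xy divides_exists by blast
    note T = divides_total[OF a]
    show "br (smul0 s \<sigma>) \<rho> = smul0 s (br \<sigma> \<rho>)"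
      using br_eq[OF gr_total_scale _ divides_scale(1)[OF _ _ a]] br_eq[OF _ _ a] xy T
      by (simp add: P_scale)
    show "br \<sigma> (smul0 s \<rho>) = smul0 s (br \<sigma> \<rho>)"
      using br_eq[OF _ gr_total_scale divides_scale(2)[OF _ _ a]] br_eq[OF _ _ a] xy T
      by (simp add: P_scale)
  qed
qed

end


section \<open>Smooth functions and differential forms\<close>

text \<open>For \<open>i < n\<close> the coordinate line through \<open>x\<close> stays in the
  coordinate space and is continuous. Functions that agree on \<open>S\<close> therefore agree near
  \<open>x i\<close> along this line and have the same partial derivatives on
  \<open>S\<close>.\<close>

lemma open_update_preimage:
  assumes S: "openin (Euclidean_space n) S" and x: "x \<in> S" and i: "i < n"
  shows "open {t. x(i := t) \<in> S}"
proof -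
  have x0: "\<forall>k\<ge>n. x k = 0"
    using x openin_subset[OF S] by (auto simp: topspace_Euclidean_space)
  have "continuous_map euclidean euclideanreal (\<lambda>t. (x(i := t)) k)" for k
    by (cases "k = i") simp_all
  hence "continuous_map euclidean (powertop_real UNIV) (\<lambda>t. x(i := t))"
    by (simp only: continuous_map_componentwise_UNIV) blast
  moreover have "(\<lambda>t. x(i := t)) \<in> topspace euclidean \<rightarrow> {x. \<forall>i\<ge>n. x i = 0}"
    using i x0 by auto
  ultimately have "continuous_map euclidean (Euclidean_space n) (\<lambda>t. x(i := t))"
    unfolding Euclidean_space_def by (intro continuous_map_into_subtopology)
  from openin_continuous_map_preimage[OF this S] show ?thesis by simp
qed

lemma continuous_map_mult_const:
  fixes f :: "'x \<Rightarrow> 'b::real_normed_algebra"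
  assumes "continuous_map T euclidean f"
  shows "continuous_map T euclidean (\<lambda>x. a * f x)"
proof -
  have "continuous_map euclidean euclidean (\<lambda>z. a * z)"
    by (auto intro: continuous_intros)
  from continuous_map_compose[OF assms this] show ?thesis by (simp add: o_def)
qed

text \<open>
  The hypothesis on \<open>h\<close> is only on \<open>S\<close>, since derivatives of \<open>f\<close> and \<open>g\<close> may be junk elsewhere.
\<close>

lemma Ck_on_linear_combination:
  fixes f g h :: "(nat \<Rightarrow> real) \<Rightarrow> 'b::real_normed_algebra"
  assumes S: "openin (Euclidean_space n) S"
    and "Ck_on n k S f" "Ck_on n k S g" "\<And>x. x \<in> S \<Longrightarrow> h x = a * f x + b * g x"
  shows "Ck_on n k S h"
  using assms(2-)
proof (induction k arbitrary: f g h)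
  case 0
  have "continuous_map (subtopology (Euclidean_space n) S) euclidean (\<lambda>x. a * f x + b * g x)"
    using 0 by (auto intro!: continuous_map_add continuous_map_mult_const)
  thus ?case using 0 by (auto elim: continuous_map_eq)
next
  case (Suc k)
  have "continuous_map (subtopology (Euclidean_space n) S) euclidean (\<lambda>x. a * f x + b * g x)"
    using Suc.prems by (auto intro!: continuous_map_add continuous_map_mult_const)
  hence cont: "continuous_map (subtopology (Euclidean_space n) S) euclidean h"
    using Suc.prems by (auto elim: continuous_map_eq)
  have deriv: "((\<lambda>t. h (x(i := t))) has_vector_derivative
      a * partial_deriv i f x + b * partial_deriv i g x) (at (x i))" if "i < n" "x \<in> S" for i x
  proof -
    have "((\<lambda>t. a * f (x(i := t)) + b * g (x(i := t))) has_vector_derivative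
      a * partial_deriv i f x + b * partial_deriv i g x) (at (x i))"
      using Suc.prems(1,2) that unfolding partial_deriv_def
      by (intro has_vector_derivative_add has_vector_derivative_mult_right vector_derivative_works[THEN iffD1])
         simp_all
    \<comment> \<open>The combination is known to equal \<open>h\<close> only on \<open>S\<close>;
      along the coordinate line this holds on an open set around \<open>x i\<close>, which suffices
      to transfer the derivative.\<close>
    moreover have "x i \<in> {t. x(i := t) \<in> S}" using that by simp
    moreover have "a * f (x(i := t)) + b * g (x(i := t)) = h (x(i := t))" if "t \<in> {t. x(i := t) \<in> S}" for t
      using that by (intro Suc.prems(3)[symmetric]) blast
    ultimately show ?thesis
      by (rule has_vector_derivative_transform_within_open[OF _ open_update_preimage[OF S that(2,1)]])
  qed
  have "Ck_on n k S (partial_deriv i h)" if i: "i < n" for i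
  proof (rule Suc.IH)
    show "Ck_on n k S (partial_deriv i f)" "Ck_on n k S (partial_deriv i g)"
      using Suc.prems(1,2) i by simp_all
    show "partial_deriv i h x = a * partial_deriv i f x + b * partial_deriv i g x" if "x \<in> S" for x
      unfolding partial_deriv_def[of i h] by (rule vector_derivative_at[OF deriv[OF i that]])
  qed
  moreover have "(\<lambda>t. h (x(i := t))) differentiable at (x i)" if "i < n" "x \<in> S" for i x
    using deriv[OF that] by (rule differentiableI_vector)
  ultimately show ?case
    using cont by simp
qed

lemma smooth_on_linear_combination:
  fixes f g :: "(nat \<Rightarrow> real) \<Rightarrow> 'b::real_normed_algebra"
  assumes "openin (Euclidean_space n) S" "smooth_on n S f" "smooth_on n S g"
  shows "smooth_on n S (\<lambda>x. a * f x + b * g x)"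
  unfolding smooth_on_def
proof
  show "Ck_on n k S (\<lambda>x. a * f x + b * g x)" for k
    by (rule Ck_on_linear_combination[OF assms(1) _ _ refl]) (use assms(2,3) in \<open>simp_all add: smooth_on_def\<close>)
qed

lemma smooth_on_zero: "smooth_on n S (\<lambda>x. 0)"
proof -
  have "Ck_on n k S (\<lambda>x. 0 :: 'a)" for k
    by (induction k) (simp_all add: partial_deriv_def[abs_def])
  thus ?thesis by (simp add: smooth_on_def)
qed

section \<open>Differential forms as a graded vector space\<close>

lemma
  assumes "\<omega> \<in> diff_forms n X A k"
  shows diff_forms_support:
      "\<omega> p vs \<noteq> 0 \<Longrightarrow> p \<in> topspace X \<and> set vs \<subseteq> tangent_space n A p \<and> int (length vs) = k"
    and diff_forms_multilinear:
      "\<lbrakk>p \<in> topspace X; set us \<union> set vs \<union> {v, w} \<subseteq> tangent_space n A p\<rbrakk> \<Longrightarrow>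
       \<omega> p (us @ (\<lambda>f. r * v f + s * w f) # vs) =
         complex_of_real r * \<omega> p (us @ v # vs) + complex_of_real s * \<omega> p (us @ w # vs)"
    and diff_forms_alternating: "\<lbrakk>p \<in> topspace X; \<not> distinct vs\<rbrakk> \<Longrightarrow> \<omega> p vs = 0"
    and diff_forms_smooth:
      "\<lbrakk>(U, \<phi>) \<in> A; set is \<subseteq> {..<n}\<rbrakk> \<Longrightarrow> smooth_on n (\<phi> ` U)
         (\<lambda>x. \<omega> (inv_into U \<phi> x) (map (coord_vec n A (U, \<phi>) (inv_into U \<phi> x)) is))"
proof -
  note D = assms[unfolded diff_forms_def mem_Collect_eq]
  show "\<omega> p vs \<noteq> 0 \<Longrightarrow> p \<in> topspace X \<and> set vs \<subseteq> tangent_space n A p \<and> int (length vs) = k"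
    using D[THEN conjunct1] by blast
  note D = D[THEN conjunct2]
  show "\<lbrakk>p \<in> topspace X; set us \<union> set vs \<union> {v, w} \<subseteq> tangent_space n A p\<rbrakk> \<Longrightarrow>
       \<omega> p (us @ (\<lambda>f. r * v f + s * w f) # vs) =
         complex_of_real r * \<omega> p (us @ v # vs) + complex_of_real s * \<omega> p (us @ w # vs)"
    using D[THEN conjunct1] by blast
  note D = D[THEN conjunct2]
  show "\<lbrakk>p \<in> topspace X; \<not> distinct vs\<rbrakk> \<Longrightarrow> \<omega> p vs = 0"
    using D[THEN conjunct1] by blast
  note D = D[THEN conjunct2]
  show "\<lbrakk>(U, \<phi>) \<in> A; set is \<subseteq> {..<n}\<rbrakk> \<Longrightarrow> smooth_on n (\<phi> ` U)
         (\<lambda>x. \<omega> (inv_into U \<phi> x) (map (coord_vec n A (U, \<phi>) (inv_into U \<phi> x)) is))"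
    using D by blast
qed

lemma diff_formsI:
  assumes "\<And>p vs. \<omega> p vs \<noteq> 0 \<Longrightarrow>
      p \<in> topspace X \<and> set vs \<subseteq> tangent_space n A p \<and> int (length vs) = k"
    and "\<And>p us vs v w r s. \<lbrakk>p \<in> topspace X; set us \<union> set vs \<union> {v, w} \<subseteq> tangent_space n A p\<rbrakk> \<Longrightarrow>
       \<omega> p (us @ (\<lambda>f. r * v f + s * w f) # vs) =
         complex_of_real r * \<omega> p (us @ v # vs) + complex_of_real s * \<omega> p (us @ w # vs)"
    and "\<And>p vs. \<lbrakk>p \<in> topspace X; \<not> distinct vs\<rbrakk> \<Longrightarrow> \<omega> p vs = 0"
    and "\<And>U \<phi> is. \<lbrakk>(U, \<phi>) \<in> A; set is \<subseteq> {..<n}\<rbrakk> \<Longrightarrow> smooth_on n (\<phi> ` U)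
         (\<lambda>x. \<omega> (inv_into U \<phi> x) (map (coord_vec n A (U, \<phi>) (inv_into U \<phi> x)) is))"
  shows "\<omega> \<in> diff_forms n X A k"
proof -
  have "\<forall>p vs. \<omega> p vs \<noteq> 0 \<longrightarrow>
      p \<in> topspace X \<and> set vs \<subseteq> tangent_space n A p \<and> int (length vs) = k"
    using assms(1) by blast
  moreover have "\<forall>p\<in>topspace X. \<forall>us vs v w r s. set us \<union> set vs \<union> {v, w} \<subseteq> tangent_space n A p \<longrightarrow>
       \<omega> p (us @ (\<lambda>f. r * v f + s * w f) # vs) =
         complex_of_real r * \<omega> p (us @ v # vs) + complex_of_real s * \<omega> p (us @ w # vs)"
    by (intro ballI allI impI assms(2))
  moreover have "\<forall>p\<in>topspace X. \<forall>vs. \<not> distinct vs \<longrightarrow> \<omega> p vs = 0"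
    using assms(3) by blast
  moreover have "\<forall>(U, \<phi>)\<in>A. \<forall>is. set is \<subseteq> {..<n} \<longrightarrow> smooth_on n (\<phi> ` U)
         (\<lambda>x. \<omega> (inv_into U \<phi> x) (map (coord_vec n A (U, \<phi>) (inv_into U \<phi> x)) is))"
    using assms(4) by blast
  ultimately show ?thesis
    unfolding diff_forms_def by (intro CollectI conjI)
qed

text \<open>The degree can be read off from the number of arguments; this separates the components
  and selects the terms of a wedge product.\<close>

lemma diff_forms_vanish:
  "\<omega> \<in> diff_forms n X A k \<Longrightarrow> int (length vs) \<noteq> k \<Longrightarrow> \<omega> p vs = 0"
  by (metis diff_forms_support)

lemma diff_forms_linear_combination:
  assumes M: "smooth_manifold n X A"
    and \<omega>: "\<omega> \<in> diff_forms n X A k" and \<eta>: "\<eta> \<in> diff_forms n X A k"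
  shows "(\<lambda>p vs. a * \<omega> p vs + b * \<eta> p vs) \<in> diff_forms n X A k"
proof (rule diff_formsI)
  fix p vs assume "a * \<omega> p vs + b * \<eta> p vs \<noteq> 0"
  hence "\<omega> p vs \<noteq> 0 \<or> \<eta> p vs \<noteq> 0" by auto
  thus "p \<in> topspace X \<and> set vs \<subseteq> tangent_space n A p \<and> int (length vs) = k"
    using diff_forms_support[OF \<omega>] diff_forms_support[OF \<eta>] by blast
next
  fix p us vs v w and r s :: real
  assume *: "p \<in> topspace X" "set us \<union> set vs \<union> {v, w} \<subseteq> tangent_space n A p"
  show "a * \<omega> p (us @ (\<lambda>f. r * v f + s * w f) # vs) + b * \<eta> p (us @ (\<lambda>f. r * v f + s * w f) # vs)
     = r * (a * \<omega> p (us @ v # vs) + b * \<eta> p (us @ v # vs)) + s * (a * \<omega> p (us @ w # vs) + b * \<eta> p (us @ w # vs))"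
    unfolding diff_forms_multilinear[OF \<omega> *] diff_forms_multilinear[OF \<eta> *] by (simp add: algebra_simps)
next
  fix p and vs :: "'a tvec list" assume "p \<in> topspace X" "\<not> distinct vs"
  thus "a * \<omega> p vs + b * \<eta> p vs = 0"
    by (simp add: diff_forms_alternating[OF \<omega>] diff_forms_alternating[OF \<eta>])
next
  fix U \<phi> "is" assume c: "(U, \<phi>) \<in> A" "set is \<subseteq> {..<n}"
  \<comment> \<open>Chart images are open in the coordinate space, as smoothness of linear
    combinations requires.\<close>
  hence "openin (Euclidean_space n) (\<phi> ` U)"
    using M by (auto simp: smooth_manifold_def is_chart_def)
  thus "smooth_on n (\<phi> ` U)
          (\<lambda>x. a * \<omega> (inv_into U \<phi> x) (map (coord_vec n A (U, \<phi>) (inv_into U \<phi> x)) is)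
             + b * \<eta> (inv_into U \<phi> x) (map (coord_vec n A (U, \<phi>) (inv_into U \<phi> x)) is))"
    using diff_forms_smooth[OF \<omega> c] diff_forms_smooth[OF \<eta> c] by (rule smooth_on_linear_combination)
qed

lemma diff_forms_zero: "0 \<in> diff_forms n X A k"
  by (auto simp: diff_forms_def smooth_on_zero)

lemma sum_form_apply: "(\<Sum>k\<in>K. c k) p vs = (\<Sum>k\<in>K. (c k :: 'm form) p vs)"
  by (induction K rule: infinite_finite_induct) auto

lemma diff_forms_graded_vector_space:
  assumes "smooth_manifold n X A"
  shows "graded_vector_space form_scale (diff_forms n X A)"
proof -
  interpret vector_space form_scale
    by standard (simp_all add: form_scale_def plus_fun_def distrib_left distrib_right mult.assoc)
  show ?thesis
  proof
    show "subspace (diff_forms n X A k)" for k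
    proof (rule subspaceI)
      show "0 \<in> diff_forms n X A k" by (rule diff_forms_zero)
    next
      fix x y assume "x \<in> diff_forms n X A k" "y \<in> diff_forms n X A k"
      thus "x + y \<in> diff_forms n X A k"
        using diff_forms_linear_combination[OF assms, of x k y 1 1] by (simp add: plus_fun_def)
    next
      fix c x assume "x \<in> diff_forms n X A k"
      thus "form_scale c x \<in> diff_forms n X A k"
        using diff_forms_linear_combination[OF assms, of x k x c 0] by (simp add: form_scale_def)
    qed
  next
    fix K and c :: "int \<Rightarrow> 'a form" and k
    assume K: "finite K" "\<And>k. k \<in> K \<Longrightarrow> c k \<in> diff_forms n X A k" "(\<Sum>k\<in>K. c k) = 0" "k \<in> K"
    have "c k p vs = 0" for p vs
    proof (cases "int (length vs) = k")
      case True
      \<comment> \<open>Evaluated on a list of length \<open>k\<close>, all summands other than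
        \<open>c k\<close> vanish.\<close>
      have "0 = (\<Sum>j\<in>K. c j) p vs" using K(3) by simp
      also have "\<dots> = (\<Sum>j\<in>K. c j p vs)" by (rule sum_form_apply)
      also have "\<dots> = (\<Sum>j\<in>{k}. c j p vs)"
        using K(1,4) True by (intro sum.mono_neutral_right) (auto intro: diff_forms_vanish[OF K(2)])
      finally show ?thesis by simp
    qed (simp add: diff_forms_vanish[OF K(2)[OF K(4)]])
    thus "c k = 0" by (intro ext) simp
  qed
qed

text \<open>This is the origin of the Koszul sign: exchanging blocks of p and q arguments costs
  (-1)^(pq).\<close>

lemma shuffle_sign_complement:
  assumes "S \<subseteq> {..<m}"
  shows "shuffle_sign m S = (-1) ^ (card S * (m - card S)) * shuffle_sign m ({..<m} - S)"
proof -
  let ?C = "{..<m} - S"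
  let ?A = "{(i, j). i \<in> S \<and> j \<in> ?C \<and> j < i}" and ?B = "{(i, j). i \<in> S \<and> j \<in> ?C \<and> i < j}"
  have fin: "finite S" "finite ?C" using assms finite_subset by auto
  txt \<open>The inversions of \<open>S\<close> and of its complement together are all pairs in \<open>S \<times> ?C\<close>.\<close>
  have "S \<times> ?C = ?A \<union> ?B" by auto (metis linorder_neqE_nat)
  moreover have "finite ?A" "finite ?B"
    by (rule finite_subset[of _ "S \<times> ?C"]; use fin in auto)+
  ultimately have "card (S \<times> ?C) = card ?A + card ?B"
    by (simp add: card_Un_disjoint disjoint_iff)
  hence c: "card S * (m - card S) = card ?A + card ?B"
    using assms fin by (simp add: card_cartesian_product card_Diff_subset)
  \<comment> \<open>A pair in increasing order for \<open>S\<close> becomes, when swapped, an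
    inversion for the complement.\<close>
  have "{(i, j). i \<in> ?C \<and> j \<in> {..<m} - ?C \<and> j < i} = prod.swap ` ?B"
    using assms by (auto simp: image_iff)
  hence "shuffle_sign m ?C = (-1) ^ card ?B"
    by (simp add: shuffle_sign_def card_image)
  thus ?thesis
    by (simp add: c shuffle_sign_def power_add)
qed

lemma wedge_graded_commute:
  assumes \<omega>: "\<omega> \<in> diff_forms n X A k" and \<eta>: "\<eta> \<in> diff_forms n X A l"
  shows "wedge \<omega> \<eta> = form_scale ((-1) powi (k * l)) (wedge \<eta> \<omega>)"
proof (intro ext)
  fix p and vs :: "'a tvec list"
  let ?m = "length vs"
  let ?I = "{..<?m}"
  have "wedge \<omega> \<eta> p vs = (\<Sum>S\<in>Pow ?I. shuffle_sign ?m (?I - S) * \<omega> p (nths vs (?I - S)) * \<eta> p (nths vs S))"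
    unfolding wedge_def
    \<comment> \<open>Complementation is an involution on the subsets of \<open>?I\<close>, so it is
      its own inverse witness.\<close>
    by (rule sum.reindex_bij_witness[of _ "\<lambda>S. ?I - S" "\<lambda>S. ?I - S"]) (auto simp: double_diff)
  also have "\<dots> = (\<Sum>S\<in>Pow ?I. (-1) powi (k * l) * (shuffle_sign ?m S * \<eta> p (nths vs S) * \<omega> p (nths vs (?I - S))))"
  proof (rule sum.cong[OF refl])
    fix S assume "S \<in> Pow ?I"
    hence S: "S \<subseteq> ?I" by simp
    have fin: "finite S" using S finite_subset by blast
    have len: "length (nths vs S) = card S" "length (nths vs (?I - S)) = ?m - card S"
    proof -
      have "{i. i < ?m \<and> i \<in> S} = S" "{i. i < ?m \<and> i \<in> ?I - S} = ?I - S" using S by auto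
      thus "length (nths vs S) = card S" "length (nths vs (?I - S)) = ?m - card S"
        using fin S by (simp_all add: length_nths card_Diff_subset)
    qed
    show "shuffle_sign ?m (?I - S) * \<omega> p (nths vs (?I - S)) * \<eta> p (nths vs S)
        = (-1) powi (k * l) * (shuffle_sign ?m S * \<eta> p (nths vs S) * \<omega> p (nths vs (?I - S)))"
    \<comment> \<open>Only splittings whose sizes match the degrees contribute; for these the
      exponent in \<open>shuffle_sign_complement\<close> is \<open>k * l\<close>.\<close>
    proof (cases "int (card S) = l \<and> int (?m - card S) = k")
      case True
      have "(-1::complex) powi (k * l) = (-1) ^ (card S * (?m - card S))"
        using True by (metis mult.commute of_nat_mult power_int_of_nat)
      thus ?thesis
        using shuffle_sign_complement[OF S] by (simp add: mult_ac flip: power_add mult_2)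
    next
      case False
      hence "\<eta> p (nths vs S) = 0 \<or> \<omega> p (nths vs (?I - S)) = 0"
        using len diff_forms_vanish[OF \<omega>] diff_forms_vanish[OF \<eta>] by metis
      thus ?thesis by auto
    qed
  qed
  also have "\<dots> = form_scale ((-1) powi (k * l)) (wedge \<eta> \<omega>) p vs"
    by (simp add: form_scale_def wedge_def sum_distrib_left)
  finally show "wedge \<omega> \<eta> p vs = form_scale ((-1) powi (k * l)) (wedge \<eta> \<omega>) p vs" .
qed

text \<open>A definite description always has some value, so the Poisson axioms alone would not say
  that the prescription determines the bracket. The first two conjuncts record this: quotients
  exist, and their images do not depend on the choices.\<close>

theorem theorem2p1:
  fixes n :: nat and X :: "'m topology" and A :: "'m chart set"
    and smul :: "complex \<Rightarrow> 'a::ab_group_add \<Rightarrow> 'a" and G :: "int \<Rightarrow> 'a set"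
    and mul :: "'a \<Rightarrow> 'a \<Rightarrow> 'a" and d :: "'a \<Rightarrow> 'a"
    and P :: "'a \<Rightarrow> 'm form" and hbar :: "'a \<Rightarrow> 'a"
  assumes manifold: "smooth_manifold n X A"
    and deformation: "dga_deformation smul G mul d
           form_scale (diff_forms n X A) wedge (ext_deriv n X A) P hbar"
  shows "(\<forall>x\<in>gr_total G. \<forall>y\<in>gr_total G. \<exists>a. divides_commutator smul G mul hbar x y a) \<and>
    (\<forall>x\<in>gr_total G. \<forall>y\<in>gr_total G. \<forall>x'\<in>gr_total G. \<forall>y'\<in>gr_total G. \<forall>a a'.
       P x = P x' \<longrightarrow> P y = P y' \<longrightarrow>
       divides_commutator smul G mul hbar x y a \<longrightarrow>
       divides_commutator smul G mul hbar x' y' a' \<longrightarrow> P a = P a') \<and>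
    dg_poisson_algebra form_scale (diff_forms n X A) wedge (ext_deriv n X A)
      (deformation_bracket smul G mul hbar P)"
proof -
  interpret commutative_dga_deformation smul G mul d form_scale "diff_forms n X A" wedge "ext_deriv n X A" P hbar
    by (intro commutative_dga_deformation.intro commutative_dga_deformation_axioms.intro deformation
        diff_forms_graded_vector_space[OF manifold] wedge_graded_commute)
  show ?thesis
    using divides_exists P_divides_unique bracket_poisson by blast
qed

end
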